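(* There exists a sequence of positive integers $(r_n)_{n\in\mathbb{N}}$ that satisfies all of the following: (i) For all real numbers $\gamma,\delta$ such that either $\gamma$ or $\delta$ is irrational, the sequence $(r_n^2\gamma+r_n\delta)_{n\in\mathbb{N}}$ is uniformly distributed in $\mathbb{T}$. (ii) The set $\{n\in\mathbb{N}\colon d\mid r_n\}$ has positive density for every $d\in\mathbb{N}$. (iii) The set $R=\{r_1,r_2,\ldots\}$ is not good for double recurrence.
   Context: $\mathbb{N}$ denotes the positive integers and $\mathbb{T}=\mathbb{R}/\mathbb{Z}$. A set of integers $\Lambda$ has positive density if the limit $d(\Lambda)=\lim_{N\to\infty}|\Lambda\cap\{-N,\ldots,N\}|/(2N+1)$ exists and is positive. A system is a quadruple $(X,\mathcal{B},\mu,T)$, where $(X,\mathcal{B},\mu)$ is a Lebesgue probability space and $T\colon X\to X$ is an invertible measurable map preserving $\mu$. A set of integers $R$ is good for double recurrence (a set of $2$-recurrence) if for every system $(X,\mathcal{B},\mu,T)$ and every $A\in\mathcal{B}$ with $\mu(A)>0$ one has $\mu(A\cap T^{-r}A\cap T^{-2r}A)>0$ for some nonzero $r\in R$. *)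

theory Defs
  imports "HOL-Probability.Probability"
begin

text \<open>Uniform distribution in \<open>\<real>/\<int>\<close> of the sequence \<open>x 1, x 2, \<dots>\<close>; the value \<open>x 0\<close> plays no role.\<close>

definition uniformly_distributed_mod1 :: "(nat \<Rightarrow> real) \<Rightarrow> bool" where
  "uniformly_distributed_mod1 x \<longleftrightarrow>
     (\<forall>a b. 0 \<le> a \<and> a < b \<and> b \<le> 1 \<longrightarrow>
        (\<lambda>N. real (card {n \<in> {1..N}. frac (x n) \<in> {a..<b}}) / real N) \<longlonglongrightarrow> b - a)"

definition has_positive_density :: "int set \<Rightarrow> bool" where
  "has_positive_density L \<longleftrightarrow>
     (\<exists>\<delta>::real. \<delta> > 0 \<and>
        (\<lambda>N. real (card (L \<inter> {- int N..int N})) / (2 * real N + 1)) \<longlonglongrightarrow> \<delta>)"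

definition polish_topology :: "'a topology \<Rightarrow> bool" where
  "polish_topology \<tau> \<longleftrightarrow> completely_metrizable_space \<tau> \<and>
     (\<exists>D. countable D \<and> D \<subseteq> topspace \<tau> \<and> \<tau> closure_of D = topspace \<tau>)"

text \<open>A Lebesgue probability space is the completion of a standard Borel probability space
  (a Polish space with its Borel sets and a Borel probability measure).\<close>

definition lebesgue_prob_space :: "'a measure \<Rightarrow> bool" where
  "lebesgue_prob_space M \<longleftrightarrow>
     (\<exists>\<tau> B. polish_topology \<tau> \<and> space B = topspace \<tau> \<and>
        sets B = sigma_sets (topspace \<tau>) {U. openin \<tau> U} \<and>
        prob_space B \<and> M = completion B)"

text \<open>Outside \<open>space M\<close> the values of \<open>T\<close> are irrelevant.\<close>

definition mp_system :: "'a measure \<Rightarrow> ('a \<Rightarrow> 'a) \<Rightarrow> bool" where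
  "mp_system M T \<longleftrightarrow> lebesgue_prob_space M \<and>
     bij_betw T (space M) (space M) \<and>
     T \<in> measurable M M \<and> the_inv_into (space M) T \<in> measurable M M \<and>
     distr M M T = M"

definition int_iterate :: "'a measure \<Rightarrow> ('a \<Rightarrow> 'a) \<Rightarrow> int \<Rightarrow> 'a \<Rightarrow> 'a" where
  "int_iterate M T k =
     (if k \<ge> 0 then T ^^ nat k else the_inv_into (space M) T ^^ nat (- k))"

text \<open>The set \<open>T\<^sup>-\<^sup>k A\<close>.\<close>

definition preimage_iterate :: "'a measure \<Rightarrow> ('a \<Rightarrow> 'a) \<Rightarrow> int \<Rightarrow> 'a set \<Rightarrow> 'a set" where
  "preimage_iterate M T k A = int_iterate M T k -` A \<inter> space M"

text \<open>HOL cannot quantify over types inside a definition, so the systems range over subsets of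
  \<open>\<real>\<close>. Nothing is lost: a Polish space has at most continuum many points, and
  \<^const>\<open>lebesgue_prob_space\<close> does not refer to the usual topology of \<open>\<real>\<close>, so every system can
  be carried over by an injection of its space into \<open>\<real>\<close>.\<close>

definition good_for_double_recurrence :: "int set \<Rightarrow> bool" where
  "good_for_double_recurrence R \<longleftrightarrow>
     (\<forall>(M :: real measure) T A. mp_system M T \<and> A \<in> sets M \<and> measure M A > 0 \<longrightarrow>
        (\<exists>r\<in>R. r \<noteq> 0 \<and>
           measure M (A \<inter> preimage_iterate M T r A \<inter> preimage_iterate M T (2 * r) A) > 0))"

end

theory Submission
  imports Defs "HOL-Real_Asymp.Real_Asymp"
begin

text \<open>Let \<open>1, \<alpha>, \<beta>\<close> be rationally independent. Along the orbit of a Heisenberg nilrotation, let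
  \<open>z\<close> be the central coordinate. When the \<open>\<beta>\<close>-coordinate is small at times \<open>0, r, 2r\<close>, the second
  difference of \<open>z\<close> equals \<open>r\<^sup>2 \<alpha> \<beta> - 2 r \<alpha> \<lfloor>r \<beta> + 1 / 2\<rfloor>\<close> modulo 1, independently of the starting point. If
  this phase lies in \<open>[1/4, 3/4)\<close> then a thin box cannot be visited at all three times, so the set \<open>R\<close>
  of such \<open>r\<close> is not good for double recurrence. On the other hand the phase is a genuine bracket
  quadratic: by van der Corput's inequality it does not correlate with any quadratic polynomial, so
  by Weyl's criterion \<open>R\<close> has density \<open>1/2\<close> and inherits equidistribution modulo 1 and in residue
  classes from \<open>\<nat>\<close>.\<close>

section \<open>Sequences of mean zero\<close>

text \<open>The simplest way to spoil double recurrence is to keep n^2 \<gamma> modulo 1 away from 0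
  for one irrational \<gamma>, but (i) forbids exactly this. The bracket has to separate the phase
  from n^2 \<gamma> + n \<delta> for all real \<gamma>, \<delta>, including those tied rationally to
  \<alpha> and \<beta>. For such values the differenced phase can be resonant at some shifts, so van
  der Corput's inequality is needed in a form that tolerates a finite set of exceptional shifts.

  The map comes from the group law (a, b, c)(x, y, z) = (a + x, b + y, c + z + a y): multiply on the
  left by (\<alpha>, \<beta>, 0), then on the right by an integer element that leads back to the
  unit cube. The latter turns z + \<alpha> y into z + \<alpha> y - (x + \<alpha>) \<lfloor>y +
  \<beta>\<rfloor> modulo 1, which is the source of the bracket.

  Weyl's criterion carries a bounded weight because it is used with exchanged roles: to study R, the
  bracket phase is the sequence and a polynomial phase the weight; to study polynomials along R, the
  indicator of R is the weight.\<close>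

definition cis2pi :: "real \<Rightarrow> complex" where
  "cis2pi x = cis (2 * pi * x)"

lemma norm_cis2pi [simp]: "norm (cis2pi x) = 1"
  by (simp add: cis2pi_def)

lemma cis2pi_0 [simp]: "cis2pi 0 = 1"
  by (simp add: cis2pi_def)

lemma cis2pi_add: "cis2pi (x + y) = cis2pi x * cis2pi y"
  by (simp add: cis2pi_def cis_mult distrib_left)

lemma cnj_cis2pi: "cnj (cis2pi x) = cis2pi (- x)"
  by (simp add: cis2pi_def cis_cnj)

lemma cis2pi_eq_1_iff: "cis2pi x = 1 \<longleftrightarrow> x \<in> \<int>"
proof
  assume "cis2pi x = 1"
  then have "cos (2 * pi * x) = 1"
    by (simp add: cis2pi_def complex_eq_iff)
  then obtain k :: int where "2 * pi * x = of_int k * 2 * pi"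
    using cos_one_2pi_int by blast
  then have "x = of_int k" by simp
  then show "x \<in> \<int>" by simp
qed (simp add: cis2pi_def)

lemma cis2pi_of_int [simp]: "cis2pi (of_int k) = 1"
  by (simp add: cis2pi_eq_1_iff)

lemma cis2pi_cong_Ints:
  assumes "x - y \<in> \<int>"
  shows "cis2pi x = cis2pi y"
  using assms cis2pi_add[of "x - y" y] by (simp add: cis2pi_eq_1_iff)

lemma cis2pi_int_mult_frac: "cis2pi (of_int j * frac x) = cis2pi (of_int j * x)"
proof (rule cis2pi_cong_Ints)
  have "of_int j * frac x - of_int j * x = of_int (- j * \<lfloor>x\<rfloor>)"
    by (simp add: frac_def algebra_simps)
  then show "of_int j * frac x - of_int j * x \<in> \<int>"
    by (metis Ints_of_int)
qed

lemma continuous_on_cis2pi [continuous_intros]: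
  "continuous_on S f \<Longrightarrow> continuous_on S (\<lambda>x. cis2pi (f x))"
  unfolding cis2pi_def by (intro continuous_intros)

definition mean_zero :: "(nat \<Rightarrow> complex) \<Rightarrow> bool" where
  "mean_zero f \<longleftrightarrow> (\<lambda>N. (\<Sum>n=1..N. f n) / of_nat N) \<longlonglongrightarrow> 0"

lemma mean_zero_add: "mean_zero f \<Longrightarrow> mean_zero g \<Longrightarrow> mean_zero (\<lambda>n. f n + g n)"
  unfolding mean_zero_def by (drule (1) tendsto_add) (simp add: sum.distrib add_divide_distrib)

lemma mean_zero_mult_left: "mean_zero f \<Longrightarrow> mean_zero (\<lambda>n. c * f n)"
  unfolding mean_zero_def by (drule tendsto_mult_left[where c=c]) (simp flip: sum_distrib_left)

lemma mean_zero_sum: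
  "finite J \<Longrightarrow> (\<And>j. j \<in> J \<Longrightarrow> mean_zero (f j)) \<Longrightarrow> mean_zero (\<lambda>n. \<Sum>j\<in>J. f j n)"
proof (induction J rule: finite_induct)
  case empty
  then show ?case by (simp add: mean_zero_def)
next
  case (insert j J)
  then show ?case by (simp add: mean_zero_add)
qed

lemma mean_zero_cnj: "mean_zero f \<Longrightarrow> mean_zero (\<lambda>n. cnj (f n))"
  unfolding mean_zero_def by (drule tendsto_cnj) simp

lemma norm_average_le:
  fixes f :: "nat \<Rightarrow> complex"
  assumes "\<And>n. norm (f n) \<le> B" "B \<ge> 0"
  shows "norm ((\<Sum>n=1..N. f n) / of_nat N) \<le> B"
proof -
  have "norm (\<Sum>n=1..N. f n) \<le> (\<Sum>n=1..N. B)"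
    using assms by (intro sum_norm_le) auto
  then show ?thesis
    using assms by (cases "N = 0") (auto simp: norm_divide field_simps)
qed

lemma norm_sum_shift_le:
  fixes f :: "nat \<Rightarrow> complex"
  assumes "\<And>n. norm (f n) \<le> B"
  shows "norm ((\<Sum>n=1..N. f (n + h)) - (\<Sum>n=1..N. f n)) \<le> 2 * B * real h"
proof (induction h)
  case (Suc h)
  have "(\<Sum>n=1..N. f (n + Suc h)) - (\<Sum>n=1..N. f (n + h)) = f (N + Suc h) - f (Suc h)"
    by (induction N) (simp_all add: algebra_simps)
  then have "norm ((\<Sum>n=1..N. f (n + Suc h)) - (\<Sum>n=1..N. f (n + h))) \<le> 2 * B"
    using norm_triangle_ineq4[of "f (N + Suc h)" "f (Suc h)"] assms[of "N + Suc h"] assms[of "Suc h"]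
    by simp
  then have "norm (((\<Sum>n=1..N. f (n + Suc h)) - (\<Sum>n=1..N. f (n + h)))
      + ((\<Sum>n=1..N. f (n + h)) - (\<Sum>n=1..N. f n))) \<le> 2 * B + 2 * B * real h"
    using Suc by (intro norm_triangle_mono)
  then show ?case by (simp add: algebra_simps)
qed auto

lemma mean_zero_shift_diff:
  assumes "\<And>n. norm (f n) \<le> B"
  shows "mean_zero (\<lambda>n. f (n + h) - f n)"
  unfolding mean_zero_def
proof (rule tendsto_norm_zero_cancel, rule tendsto_sandwich)
  show "\<forall>\<^sub>F N in sequentially. 0 \<le> norm ((\<Sum>n=1..N. f (n + h) - f n) / of_nat N)"
    by simp
  show "\<forall>\<^sub>F N in sequentially.
      norm ((\<Sum>n=1..N. f (n + h) - f n) / of_nat N) \<le> 2 * B * real h / real N"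
    using norm_sum_shift_le[of f B, OF assms]
    by (intro always_eventually allI) (simp add: norm_divide sum_subtractf divide_right_mono)
  show "(\<lambda>N. 2 * B * real h / real N) \<longlonglongrightarrow> 0"
    by (rule lim_const_over_n)
qed simp

lemma mean_zero_shift:
  assumes "\<And>n. norm (f n) \<le> B" "mean_zero f"
  shows "mean_zero (\<lambda>n. f (n + h))"
  using mean_zero_add[OF mean_zero_shift_diff[of f B h, OF assms(1)] assms(2)] by simp

text \<open>Such an \<open>f\<close> is the coboundary (f (n + q) - f n) / (c - 1), whose sums
  telescope up to boundary terms. The case \<open>q = 1\<close> gives linear phases; larger
  \<open>q\<close> serves quadratic phases with rational leading coefficient.\<close>

lemma mean_zero_eigenfunction:
  assumes bound: "\<And>n. norm (f n) \<le> B"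
    and eig: "\<And>n. f (n + q) = c * f n" and "c \<noteq> 1"
  shows "mean_zero f"
proof -
  have "mean_zero (\<lambda>n. (1 / (c - 1)) * (f (n + q) - f n))"
    by (intro mean_zero_mult_left mean_zero_shift_diff[OF bound])
  also have "(\<lambda>n. (1 / (c - 1)) * (f (n + q) - f n)) = f"
    using \<open>c \<noteq> 1\<close> by (auto simp: eig field_simps)
  finally show ?thesis .
qed

lemma mean_zero_linear_phase:
  assumes "\<theta> \<notin> \<int>"
  shows "mean_zero (\<lambda>n. cis2pi (real n * \<theta>))"
  using assms
  by (intro mean_zero_eigenfunction[of _ 1 1 "cis2pi \<theta>"])
     (simp_all add: cis2pi_eq_1_iff distrib_right flip: cis2pi_add)

lemma mean_zeroI_eventually:
  assumes "\<And>\<epsilon>. \<epsilon> > 0 \<Longrightarrow> \<forall>\<^sub>F N in sequentially. norm ((\<Sum>n=1..N. f n) / of_nat N) \<le> \<epsilon>"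
  shows "mean_zero f"
  unfolding mean_zero_def
proof (rule tendstoI)
  fix e :: real assume "e > 0"
  then show "\<forall>\<^sub>F N in sequentially. dist ((\<Sum>n=1..N. f n) / of_nat N) 0 < e"
    using eventually_mono[OF assms[of "e/2"], of "\<lambda>N. dist ((\<Sum>n=1..N. f n) / of_nat N) 0 < e"]
    by simp
qed

text \<open>The error is controlled by a sequence \<open>q\<close> that is small only on average: an
  indicator function is not a uniform limit of continuous functions. A constant \<open>q\<close>
  covers uniform approximation.\<close>

lemma mean_zero_approx:
  assumes "\<And>\<epsilon>. \<epsilon> > 0 \<Longrightarrow> \<exists>g (q :: nat \<Rightarrow> real) c. c \<le> \<epsilon> \<and> mean_zero g \<and>
      mean_zero (\<lambda>n. of_real (q n - c)) \<and> (\<forall>n. norm (f n - g n) \<le> q n)"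
  shows "mean_zero f"
proof (rule mean_zeroI_eventually)
  fix \<epsilon> :: real assume "\<epsilon> > 0"
  then obtain g and q :: "nat \<Rightarrow> real" and c where c: "c \<le> \<epsilon> / 3" and g: "mean_zero g"
    and q: "mean_zero (\<lambda>n. of_real (q n - c))" and le: "\<And>n. norm (f n - g n) \<le> q n"
    using assms[of "\<epsilon> / 3"] by auto
  have "\<forall>\<^sub>F N in sequentially. norm ((\<Sum>n=1..N. g n) / of_nat N) < \<epsilon> / 3"
    using g \<open>\<epsilon> > 0\<close> unfolding mean_zero_def by (auto dest: tendstoD[where e="\<epsilon>/3"])
  moreover have "\<forall>\<^sub>F N in sequentially.
      norm ((\<Sum>n=1..N. complex_of_real (q n - c)) / of_nat N) < \<epsilon> / 3"
    using q \<open>\<epsilon> > 0\<close> unfolding mean_zero_def by (auto dest: tendstoD[where e="\<epsilon>/3"])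
  ultimately show "\<forall>\<^sub>F N in sequentially. norm ((\<Sum>n=1..N. f n) / of_nat N) \<le> \<epsilon>"
    using eventually_gt_at_top[of 0]
  proof eventually_elim
    case (elim N)
    have "(\<Sum>n=1..N. complex_of_real (q n - c)) / of_nat N
        = complex_of_real ((\<Sum>n=1..N. q n) / real N - c)"
      using \<open>N > 0\<close> by (simp add: sum_subtractf field_simps)
    then have "\<bar>(\<Sum>n=1..N. q n) / real N - c\<bar> < \<epsilon> / 3"
      using elim(2) by (simp only: norm_of_real)
    then have q': "(\<Sum>n=1..N. q n) / real N \<le> \<epsilon> / 3 + \<epsilon> / 3"
      using c by linarith
    have "norm (\<Sum>n=1..N. f n - g n) \<le> (\<Sum>n=1..N. q n)"
      by (intro sum_norm_le le)
    then have "norm ((\<Sum>n=1..N. f n - g n) / of_nat N) \<le> (\<Sum>n=1..N. q n) / real N"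
      unfolding norm_divide norm_of_nat by (rule divide_right_mono) simp
    note order_trans[OF this q']
    then have "norm ((\<Sum>n=1..N. f n - g n) / of_nat N + (\<Sum>n=1..N. g n) / of_nat N) \<le> \<epsilon>"
      using elim(1) by (intro order_trans[OF norm_triangle_ineq]) auto
    then show ?case by (simp add: sum_subtractf diff_divide_distrib)
  qed
qed

lemma real_mean_zero_iff:
  "mean_zero (\<lambda>n. complex_of_real (f n)) \<longleftrightarrow> (\<lambda>N. (\<Sum>n=1..N. f n) / real N) \<longlonglongrightarrow> 0"
  using tendsto_of_real_iff[where 'a=complex and c=0,
      of "\<lambda>N. (\<Sum>n=1..N. f n) / real N" sequentially]
  by (simp add: mean_zero_def)

section \<open>Van der Corput's inequality\<close>

lemma norm_sum_power2_eq:
  fixes z :: "nat \<Rightarrow> complex"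
  shows "complex_of_real ((norm (\<Sum>h\<in>S. z h))\<^sup>2) = (\<Sum>h\<in>S. \<Sum>k\<in>S. z h * cnj (z k))"
  by (simp add: complex_norm_square sum_product del: of_real_power)

lemma mean_square_le:
  fixes f :: "nat \<Rightarrow> complex"
  shows "(norm ((\<Sum>n=1..N. f n) / of_nat N))\<^sup>2 \<le> (\<Sum>n=1..N. (norm (f n))\<^sup>2) / real N"
proof (cases "N = 0")
  case False
  have "(norm (\<Sum>n=1..N. f n))\<^sup>2 \<le> (\<Sum>n=1..N. norm (f n))\<^sup>2"
    by (intro power_mono norm_sum) simp
  also have "\<dots> \<le> real N * (\<Sum>n=1..N. (norm (f n))\<^sup>2)"
    using Cauchy_Schwarz_ineq_sum[of "\<lambda>_. 1" "\<lambda>n. norm (f n)" "{1..N}"] by simp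
  finally show ?thesis
    using False by (simp add: norm_divide power_divide field_simps power2_eq_square)
qed simp

text \<open>Averaging \<open>f\<close> over \<open>H\<close> consecutive shifts barely changes its
  mean, and the mean square of the averaged sequence is a mean of H^2 correlations. Per row at most
  \<open>2 * card E + 1\<close> of them fail to tend to 0, a proportion that vanishes as
  \<open>H\<close> grows.\<close>

lemma van_der_corput:
  assumes bound: "\<And>n. norm (f n) \<le> 1"
    and fin: "finite E"
    and mz: "\<And>h. h \<ge> 1 \<Longrightarrow> h \<notin> E \<Longrightarrow> mean_zero (\<lambda>n. f (n + h) * cnj (f n))"
  shows "mean_zero f"
proof (rule mean_zeroI_eventually)
  fix \<epsilon> :: real assume "\<epsilon> > 0"
  define m where "m = 2 * card E + 1"
  \<comment> \<open>With this size the bad pairs contribute at most \<epsilon>^2 / 8 to the mean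
    square; the good ones contribute another \<epsilon>^2 / 8, and the total is (\<epsilon> /
    2)^2.\<close>
  define H where "H = nat \<lceil>8 * real m / \<epsilon>\<^sup>2\<rceil> + 1"
  have "H > 0" by (simp add: H_def)
  have "real H \<ge> 8 * real m / \<epsilon>\<^sup>2"
    unfolding H_def by linarith
  then have H: "real m / real H \<le> \<epsilon>\<^sup>2 / 8"
    using \<open>\<epsilon> > 0\<close> \<open>H > 0\<close> by (simp add: field_simps)
  define A where "A h k N = (\<Sum>n=1..N. f (n + h) * cnj (f (n + k))) / of_nat N" for h k N
  \<comment> \<open>Truncated subtraction can only put the additional index 0 into
    \<open>Bad h\<close>, which does not affect the count.\<close>
  define Bad where "Bad h = {k. k = h} \<union> (\<lambda>e. h + e) ` E \<union> (\<lambda>e. h - e) ` E" for h :: nat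
  have card_Bad: "card (Bad h) \<le> m" and fin_Bad: "finite (Bad h)" for h
  proof -
    have "card (Bad h) \<le> card {k. k = h} + card ((\<lambda>e. h + e) ` E) + card ((\<lambda>e. h - e) ` E)"
      unfolding Bad_def by (meson add_le_mono1 card_Un_le order_trans)
    also have "\<dots> \<le> m"
      using card_image_le[OF fin, of "\<lambda>e. h + e"] card_image_le[OF fin, of "\<lambda>e. h - e"]
      by (simp add: m_def)
    finally show "card (Bad h) \<le> m" .
    show "finite (Bad h)" using fin by (simp add: Bad_def)
  qed
  have A_le: "norm (A h k N) \<le> 1" for h k N
    unfolding A_def
    by (rule norm_average_le) (use bound in \<open>auto simp: norm_mult intro: mult_le_one\<close>)
  have A_lim: "(\<lambda>N. A h k N) \<longlonglongrightarrow> 0" if "k \<notin> Bad h" for h k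
  proof -
    have bd: "norm (f (n + i) * cnj (f n)) \<le> 1" for n i
      using bound by (auto simp: norm_mult intro: mult_le_one)
    have "mean_zero (\<lambda>n. f (n + h) * cnj (f (n + k)))"
    proof (cases "h < k")
      case True
      then have "k - h \<ge> 1" "k - h \<notin> E" using that by (force simp: Bad_def)+
      then have "mean_zero (\<lambda>n. cnj (f (n + h + (k - h)) * cnj (f (n + h))))"
        by (intro mean_zero_cnj mean_zero_shift[OF bd] mz)
      with True show ?thesis by (simp add: mult.commute)
    next
      case False
      then have "h - k \<ge> 1" "h - k \<notin> E"
        using that by (force simp: Bad_def image_iff)+
      then have "mean_zero (\<lambda>n. f (n + k + (h - k)) * cnj (f (n + k)))"
        by (intro mean_zero_shift[OF bd] mz)
      with False show ?thesis by simp
    qed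
    then show ?thesis by (simp add: mean_zero_def A_def)
  qed
  have ev1: "\<forall>\<^sub>F N in sequentially. \<forall>h\<in>{..<H}. \<forall>k\<in>{..<H} - Bad h. norm (A h k N) \<le> \<epsilon>\<^sup>2 / 8"
  proof (intro eventually_ball_finite ballI)
    fix h k assume "k \<in> {..<H} - Bad h"
    then show "\<forall>\<^sub>F N in sequentially. norm (A h k N) \<le> \<epsilon>\<^sup>2 / 8"
      using tendstoD[OF A_lim, of k h "\<epsilon>\<^sup>2 / 8"] \<open>\<epsilon> > 0\<close> by (auto elim: eventually_mono)
  qed auto
  have "(\<lambda>N. 2 * real H / real N) \<longlonglongrightarrow> 0"
    by (rule lim_const_over_n)
  then have ev2: "\<forall>\<^sub>F N in sequentially. 2 * real H / real N < \<epsilon> / 2"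
    using \<open>\<epsilon> > 0\<close> by (auto dest!: tendstoD[where e="\<epsilon>/2"])
  show "\<forall>\<^sub>F N in sequentially. norm ((\<Sum>n=1..N. f n) / of_nat N) \<le> \<epsilon>"
    using ev1 ev2 eventually_gt_at_top[of 0]
  proof eventually_elim
    case (elim N)
    \<comment> \<open>The mean square of \<open>F\<close> expands into the correlations
      \<open>A h k N\<close>, while the means of \<open>f\<close> and \<open>F\<close> differ by at
      most 2 H / N.\<close>
    define F where "F n = (\<Sum>h<H. f (n + h)) / of_nat H" for n
    have "(\<Sum>n=1..N. (norm (F n))\<^sup>2) / real N
        = norm (complex_of_real ((\<Sum>n=1..N. (norm (F n))\<^sup>2) / real N))"
      by (subst norm_of_real) (simp add: sum_nonneg)
    also have "complex_of_real ((\<Sum>n=1..N. (norm (F n))\<^sup>2) / real N)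
        = (\<Sum>n=1..N. (\<Sum>h<H. \<Sum>k<H. f (n + h) * cnj (f (n + k)))) / of_nat H ^ 2 / of_nat N"
    proof -
      have "complex_of_real ((norm (F n))\<^sup>2)
          = (\<Sum>h<H. \<Sum>k<H. f (n + h) * cnj (f (n + k))) / of_nat H ^ 2" for n
        unfolding F_def norm_divide power_divide of_real_divide norm_sum_power2_eq
        by (simp add: norm_of_nat)
      then show ?thesis
        by (simp only: of_real_divide of_real_sum of_real_of_nat_eq sum_divide_distrib)
    qed
    also have "\<dots> = (\<Sum>h<H. \<Sum>k<H. A h k N) / of_nat H ^ 2"
    proof -
      have "(\<Sum>n=1..N. (\<Sum>h<H. \<Sum>k<H. f (n + h) * cnj (f (n + k))))
          = (\<Sum>h<H. \<Sum>k<H. \<Sum>n=1..N. f (n + h) * cnj (f (n + k)))"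
        by (subst sum.swap, rule sum.cong[OF refl], subst sum.swap, rule refl)
      then show ?thesis
        by (simp add: A_def flip: sum_divide_distrib)
    qed
    also have "norm \<dots> \<le> \<epsilon>\<^sup>2 / 4"
    proof -
      have inner: "norm (\<Sum>k<H. A h k N) \<le> real m + real H * (\<epsilon>\<^sup>2 / 8)" if "h < H" for h
      proof -
        have "norm (\<Sum>k<H. A h k N) \<le> (\<Sum>k<H. (if k \<in> Bad h then 1 else 0) + \<epsilon>\<^sup>2 / 8)"
        proof (rule sum_norm_le)
          fix k assume "k \<in> {..<H}"
          then show "norm (A h k N) \<le> (if k \<in> Bad h then 1 else 0) + \<epsilon>\<^sup>2 / 8"
            using elim(1) that A_le[of h k N] by (auto intro: order_trans)
        qed
        also have "\<dots> = real (card ({..<H} \<inter> Bad h)) + real H * (\<epsilon>\<^sup>2 / 8)"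
          by (simp add: sum.distrib sum.If_cases)
        also have "real (card ({..<H} \<inter> Bad h)) \<le> real m"
          using card_mono[OF fin_Bad[of h], of "{..<H} \<inter> Bad h"] card_Bad[of h] by simp
        finally show ?thesis by simp
      qed
      have "norm (\<Sum>h<H. \<Sum>k<H. A h k N) \<le> (\<Sum>h<H. real m + real H * (\<epsilon>\<^sup>2 / 8))"
        by (rule sum_norm_le, rule inner) simp
      also have "\<dots> = real H * (real m + real H * (\<epsilon>\<^sup>2 / 8))"
        by simp
      finally have "norm ((\<Sum>h<H. \<Sum>k<H. A h k N) / of_nat H ^ 2)
          \<le> real H * (real m + real H * (\<epsilon>\<^sup>2 / 8)) / real H ^ 2"
        by (simp add: norm_divide norm_power divide_right_mono)
      also have "\<dots> = real m / real H + \<epsilon>\<^sup>2 / 8"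
        using \<open>H > 0\<close> by (simp add: field_simps power2_eq_square)
      also have "\<dots> \<le> \<epsilon>\<^sup>2 / 4" using H by linarith
      finally show ?thesis .
    qed
    also have "\<epsilon>\<^sup>2 / 4 = (\<epsilon> / 2)\<^sup>2"
      by (simp add: power_divide)
    finally have "(norm ((\<Sum>n=1..N. F n) / of_nat N))\<^sup>2 \<le> (\<epsilon> / 2)\<^sup>2"
      by (rule order_trans[OF mean_square_le])
    then have F: "norm ((\<Sum>n=1..N. F n) / of_nat N) \<le> \<epsilon> / 2"
      by (rule power2_le_imp_le) (use \<open>\<epsilon> > 0\<close> in simp)
    have "(\<Sum>n=1..N. f n) - (\<Sum>n=1..N. F n)
        = (\<Sum>h<H. (\<Sum>n=1..N. f n) - (\<Sum>n=1..N. f (n + h))) / of_nat H"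
    proof -
      have "(\<Sum>n=1..N. F n) = (\<Sum>h<H. \<Sum>n=1..N. f (n + h)) / of_nat H"
        unfolding F_def by (subst sum.swap) (simp add: sum_divide_distrib)
      then show ?thesis using \<open>H > 0\<close> by (simp add: sum_subtractf diff_divide_distrib)
    qed
    also have "norm \<dots> \<le> 2 * real H"
    proof -
      have "norm (\<Sum>h<H. (\<Sum>n=1..N. f n) - (\<Sum>n=1..N. f (n + h))) \<le> (\<Sum>h<H. 2 * real H)"
      proof (rule sum_norm_le)
        fix h assume "h \<in> {..<H}"
        then show "norm ((\<Sum>n=1..N. f n) - (\<Sum>n=1..N. f (n + h))) \<le> 2 * real H"
          using norm_sum_shift_le[where f=f and B=1 and N=N and h=h, OF bound]
          by (simp add: norm_minus_commute)
      qed
      then show ?thesis using \<open>H > 0\<close> by (simp add: norm_divide field_simps)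
    qed
    finally have "norm (((\<Sum>n=1..N. f n) - (\<Sum>n=1..N. F n)) / of_nat N) \<le> 2 * real H / real N"
      unfolding norm_divide norm_of_nat by (rule divide_right_mono) simp
    note order_trans[OF this less_imp_le[OF elim(2)]]
    then have "norm (((\<Sum>n=1..N. f n) - (\<Sum>n=1..N. F n)) / of_nat N
        + (\<Sum>n=1..N. F n) / of_nat N) \<le> \<epsilon>"
      using F by (intro order_trans[OF norm_triangle_ineq]) auto
    then show ?case by (simp add: diff_divide_distrib)
  qed
qed

section \<open>Weyl's criterion with weights\<close>

inductive trig_poly :: "(real \<Rightarrow> complex) \<Rightarrow> bool" where
  monom: "trig_poly (\<lambda>x. c * cis2pi (of_int j * x))"
| add: "trig_poly f \<Longrightarrow> trig_poly g \<Longrightarrow> trig_poly (\<lambda>x. f x + g x)"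

lemma trig_poly_mult:
  assumes "trig_poly f" "trig_poly g"
  shows "trig_poly (\<lambda>x. f x * g x)"
  using assms
proof (induction f rule: trig_poly.induct)
  case (monom c j)
  then show ?case
  proof (induction g rule: trig_poly.induct)
    case (monom d k)
    have "(\<lambda>x. c * cis2pi (of_int j * x) * (d * cis2pi (of_int k * x)))
        = (\<lambda>x. (c * d) * cis2pi (of_int (j + k) * x))"
      by (simp add: ring_distribs cis2pi_add mult_ac)
    then show ?case by (simp only: trig_poly.monom)
  next
    case (add g h)
    then show ?case using trig_poly.add[OF add.IH] by (simp add: distrib_left)
  qed
next
  case (add f h)
  show ?case
    using trig_poly.add[OF add.IH(1)[OF add.prems] add.IH(2)[OF add.prems]]
    by (simp add: distrib_right)
qed

text \<open>This adapts the real form of Stone-Weierstrass, whose approximants are polynomials in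
  real-linear functionals of z. On the unit circle such a functional is a combination of z and its
  conjugate, that is, of the frequencies 1 and -1.\<close>

lemma trig_poly_real_polynomial:
  assumes "real_polynomial_function p"
  shows "trig_poly (\<lambda>x. of_real (p (cis2pi x)))"
  using assms
proof (induction p rule: real_polynomial_function.induct)
  case (linear f)
  interpret f: bounded_linear f by fact
  have f_eq: "f z = Re z * f 1 + Im z * f \<i>" for z
  proof -
    have "z = Re z *\<^sub>R 1 + Im z *\<^sub>R \<i>"
      by (simp add: complex_eq_iff)
    then show ?thesis by (metis f.add f.scale real_scaleR_def)
  qed
  have "(\<lambda>x. complex_of_real (f (cis2pi x)))
      = (\<lambda>x. Complex (f 1 / 2) (- f \<i> / 2) * cis2pi (of_int 1 * x)
           + Complex (f 1 / 2) (f \<i> / 2) * cis2pi (of_int (- 1) * x))"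
    by (rule ext, subst f_eq) (simp add: complex_eq_iff cis2pi_def)
  then show ?case by (simp only: trig_poly.add trig_poly.monom)
next
  case (const c)
  show ?case using trig_poly.monom[of "of_real c" 0] by simp
next
  case (add f g)
  show ?case using trig_poly.add[OF add.IH] by simp
next
  case (mult f g)
  show ?case using trig_poly_mult[OF mult.IH] by simp
qed

lemma trig_poly_frac: "trig_poly f \<Longrightarrow> f (frac x) = f x"
  by (induction rule: trig_poly.induct) (simp_all add: cis2pi_int_mult_frac)

lemma has_integral_cis2pi:
  assumes "j \<noteq> 0"
  shows "((\<lambda>x. cis2pi (of_int j * x)) has_integral 0) {0..1}"
proof -
  define c where "c = \<i> * of_real (2 * pi * of_int j)"
  have "c \<noteq> 0" using assms by (simp add: c_def)
  have exp: "cis2pi (of_int j * x) = exp (c * of_real x)" for x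
    by (simp add: cis2pi_def cis_conv_exp c_def mult_ac)
  have "((\<lambda>x. exp (c * of_real x)) has_integral exp (c * of_real 1) / c - exp (c * of_real 0) / c) {0..1}"
  proof (rule fundamental_theorem_of_calculus)
    fix x :: real
    have "((\<lambda>z. exp (c * z) / c) has_field_derivative exp (c * of_real x)) (at (of_real x))"
      using \<open>c \<noteq> 0\<close> by (auto intro!: derivative_eq_intros)
    then show "((\<lambda>x. exp (c * of_real x) / c) has_vector_derivative exp (c * of_real x))
        (at x within {0..1})"
      by (rule has_vector_derivative_real_field)
  qed simp
  moreover have "exp (c * of_real 1) = 1"
    using exp[of 1] cis2pi_of_int[of j] by simp
  ultimately show ?thesis by (simp add: exp)
qed

text \<open>Only the frequency 0 survives integration, and subtracting the integral removes
  precisely that frequency from the weighted sum.\<close>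

lemma mean_zero_trig_poly:
  assumes "trig_poly f"
    and "\<And>j. j \<noteq> 0 \<Longrightarrow> mean_zero (\<lambda>n. cis2pi (of_int j * x n) * w n)"
  obtains I where "(f has_integral I) {0..1}" "mean_zero (\<lambda>n. (f (x n) - I) * w n)"
proof -
  have "\<exists>I. (f has_integral I) {0..1} \<and> mean_zero (\<lambda>n. (f (x n) - I) * w n)"
    using assms(1)
  proof (induction rule: trig_poly.induct)
    case (monom c j)
    show ?case
    proof (cases "j = 0")
      case True
      then show ?thesis
        using has_integral_const_real[of c 0 1] by (intro exI[of _ c]) (simp add: mean_zero_def)
    next
      case False
      have "((\<lambda>x. c * cis2pi (of_int j * x)) has_integral c * 0) {0..1}"
        by (intro has_integral_mult_right has_integral_cis2pi False)
      moreover have "mean_zero (\<lambda>n. c * (cis2pi (of_int j * x n) * w n))"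
        by (intro mean_zero_mult_left assms(2) False)
      ultimately show ?thesis by (intro exI[of _ 0]) (simp add: mult_ac)
    qed
  next
    case (add f g)
    then obtain I J where "(f has_integral I) {0..1}" "mean_zero (\<lambda>n. (f (x n) - I) * w n)"
      "(g has_integral J) {0..1}" "mean_zero (\<lambda>n. (g (x n) - J) * w n)" by blast
    then have "((\<lambda>x. f x + g x) has_integral I + J) {0..1}"
      "mean_zero (\<lambda>n. (f (x n) - I) * w n + (g (x n) - J) * w n)"
      by (auto intro: has_integral_add mean_zero_add)
    then show ?case by (intro exI[of _ "I + J"]) (simp add: algebra_simps)
  qed
  then show ?thesis using that by blast
qed

lemma trig_poly_approx:
  fixes g :: "real \<Rightarrow> real"
  assumes g: "continuous_on {0..1} g" and per: "g 0 = g 1" and "\<epsilon> > 0"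
  obtains f where "trig_poly f" "\<And>x. x \<in> {0..1} \<Longrightarrow> norm (of_real (g x) - f x) < \<epsilon>"
proof -
  \<comment> \<open>\<open>g\<close> regarded as a function on the unit circle. The point 1 has
    argument 0, so \<open>g 0 = g 1\<close> is what makes \<open>G (cis2pi 1)\<close>
    correct.\<close>
  define G where "G z = g (Arg2pi z / (2 * pi))" for z
  have G_cis: "G (cis2pi x) = g x" if "x \<in> {0..1}" for x
  proof (cases "x = 1")
    case True
    then show ?thesis using per cis2pi_of_int[of 1] Arg2pi_of_real[of 1] by (simp add: G_def)
  next
    case False
    have "Arg2pi (exp (\<i> * of_real (2 * pi * x))) = 2 * pi * x"
      using False that by (subst Arg2pi_exp) auto
    then show ?thesis by (simp add: G_def cis2pi_def cis_conv_exp)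
  qed
  have surj: "\<exists>x\<in>{0..1}. z = cis2pi x" if "z \<in> sphere 0 1" for z
  proof (intro bexI[of _ "Arg2pi z / (2 * pi)"])
    show "z = cis2pi (Arg2pi z / (2 * pi))"
      using that Arg2pi_eq[of z] by (simp add: cis2pi_def cis_conv_exp)
    show "Arg2pi z / (2 * pi) \<in> {0..1}"
      using Arg2pi_ge_0[of z] Arg2pi_lt_2pi[of z] by simp
  qed
  have "continuous_on (sphere 0 1) G"
    \<comment> \<open>\<open>Arg2pi\<close> jumps at 1, so composing continuous maps does not work.
      Instead the preimage of a closed set under \<open>G\<close> is the image under
      \<open>cis2pi\<close> of a compact subset of [0, 1], hence closed.\<close>
    unfolding continuous_on_closed_vimage[OF closed_sphere]
  proof (intro allI impI)
    fix B :: "real set" assume "closed B"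
    have "G -` B \<inter> sphere 0 1 = cis2pi ` (g -` B \<inter> {0..1})"
    proof (intro set_eqI iffI)
      fix z assume z: "z \<in> G -` B \<inter> sphere 0 1"
      then obtain x where "x \<in> {0..1}" "z = cis2pi x" using surj by blast
      with z show "z \<in> cis2pi ` (g -` B \<inter> {0..1})" by (auto simp: G_cis)
    qed (auto simp: G_cis)
    moreover have "compact ({0..1} \<inter> g -` B)"
      using continuous_closed_preimage[OF g closed_atLeastAtMost \<open>closed B\<close>]
      by (simp add: compact_eq_bounded_closed bounded_Int)
    then have "compact (cis2pi ` ({0..1} \<inter> g -` B))"
      by (intro compact_continuous_image continuous_intros)
    ultimately show "closed (G -` B \<inter> sphere 0 1)"
      by (simp add: compact_imp_closed Int_commute)
  qed
  note cont = this
  obtain p where p: "real_polynomial_function p"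
    "\<And>z. z \<in> sphere 0 1 \<Longrightarrow> \<bar>G z - p z\<bar> < \<epsilon>"
    by (rule Stone_Weierstrass_real_polynomial_function[OF compact_sphere cont \<open>\<epsilon> > 0\<close>])
       (rule that)
  show ?thesis
  proof (rule that[OF trig_poly_real_polynomial[OF p(1)]])
    fix x :: real assume "x \<in> {0..1}"
    moreover have "\<bar>G (cis2pi x) - p (cis2pi x)\<bar> < \<epsilon>"
      by (rule p(2)) simp
    ultimately have "\<bar>g x - p (cis2pi x)\<bar> < \<epsilon>"
      by (simp only: G_cis)
    then show "norm (complex_of_real (g x) - of_real (p (cis2pi x))) < \<epsilon>"
      by (metis norm_of_real of_real_diff real_norm_def)
  qed
qed

text \<open>Subtracting the integral of \<open>g\<close> kills the frequency 0, the only one at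
  which \<open>w\<close> itself would be averaged. Hence the conclusion compares \<open>g\<close>
  with its integral under the weight and says nothing about the mean of \<open>w\<close>.\<close>

lemma weyl_continuous:
  fixes g :: "real \<Rightarrow> real" and w :: "nat \<Rightarrow> complex"
  assumes bound: "\<And>n. norm (w n) \<le> 1"
    and mz: "\<And>j. j \<noteq> 0 \<Longrightarrow> mean_zero (\<lambda>n. cis2pi (of_int j * x n) * w n)"
    and g: "continuous_on {0..1} g" "g 0 = g 1"
  shows "mean_zero (\<lambda>n. of_real (g (frac (x n)) - integral {0..1} g) * w n)"
proof (rule mean_zero_approx)
  fix \<epsilon> :: real assume "\<epsilon> > 0"
  then obtain f where f: "trig_poly f"
    and close: "\<And>x. x \<in> {0..1} \<Longrightarrow> norm (of_real (g x) - f x) < \<epsilon> / 2"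
    using trig_poly_approx[OF g, of "\<epsilon> / 2"] by auto
  obtain I where I: "(f has_integral I) {0..1}" and fI: "mean_zero (\<lambda>n. (f (x n) - I) * w n)"
    using mean_zero_trig_poly[OF f mz] by blast
  have "((\<lambda>x. complex_of_real (g x) - f x) has_integral of_real (integral {0..1} g) - I) {0..1}"
    using I g by (intro has_integral_diff has_integral_of_real integrable_integral)
      (simp_all add: integrable_continuous_real)
  then have "norm (of_real (integral {0..1} g) - I) \<le> \<epsilon> / 2 * measure lborel {0..1::real}"
    by (rule has_integral_bound_real[OF _ finite.emptyI, rotated])
       (use \<open>\<epsilon> > 0\<close> close in \<open>auto intro: less_imp_le\<close>)
  then have int: "norm (of_real (integral {0..1} g) - I) \<le> \<epsilon> / 2" by simp
  have "norm (of_real (g (frac (x n)) - integral {0..1} g) * w n - (f (x n) - I) * w n) \<le> \<epsilon>" for n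
  proof -
    have "frac (x n) \<in> {0..1}"
      using frac_ge_0[of "x n"] frac_lt_1[of "x n"] by simp
    then have c: "norm (of_real (g (frac (x n))) - f (x n)) \<le> \<epsilon> / 2"
      using close[of "frac (x n)"] by (simp add: trig_poly_frac[OF f])
    have "of_real (g (frac (x n)) - integral {0..1} g) * w n - (f (x n) - I) * w n
        = ((of_real (g (frac (x n))) - f (x n)) - (of_real (integral {0..1} g) - I)) * w n"
      by (simp add: algebra_simps)
    also have "norm \<dots> \<le> \<epsilon> * 1"
      unfolding norm_mult
    proof (rule mult_mono)
      show "norm ((of_real (g (frac (x n))) - f (x n)) - (of_real (integral {0..1} g) - I)) \<le> \<epsilon>"
        by (rule order_trans[OF norm_triangle_ineq4]) (use c int in linarith)
    qed (use bound \<open>\<epsilon> > 0\<close> in auto)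
    finally show ?thesis by simp
  qed
  then show "\<exists>g' (q :: nat \<Rightarrow> real) c. c \<le> \<epsilon> \<and> mean_zero g' \<and>
      mean_zero (\<lambda>n. of_real (q n - c)) \<and>
      (\<forall>n. norm (of_real (g (frac (x n)) - integral {0..1} g) * w n - g' n) \<le> q n)"
    using fI by (intro exI[of _ "\<lambda>n. (f (x n) - I) * w n"] exI[of _ "\<lambda>_. \<epsilon>"] exI[of _ \<epsilon>])
      (simp add: mean_zero_def)
qed

section \<open>Weyl's criterion for intervals\<close>

definition trapezoid :: "real \<Rightarrow> real \<Rightarrow> real \<Rightarrow> real \<Rightarrow> real" where
  "trapezoid \<delta> a b x = max 0 (min 1 (min ((x - a) / \<delta>) ((b - x) / \<delta>)))"

lemma continuous_on_trapezoid: "\<delta> > 0 \<Longrightarrow> continuous_on S (trapezoid \<delta> a b)"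
  unfolding trapezoid_def [abs_def] by (intro continuous_intros) auto

lemma trapezoid_nonneg: "trapezoid \<delta> a b x \<ge> 0"
  and trapezoid_le_1: "trapezoid \<delta> a b x \<le> 1"
  by (auto simp: trapezoid_def)

lemma trapezoid_outside: "\<delta> > 0 \<Longrightarrow> x \<le> a \<or> b \<le> x \<Longrightarrow> trapezoid \<delta> a b x = 0"
proof -
  assume "\<delta> > 0" "x \<le> a \<or> b \<le> x"
  then have "(x - a) / \<delta> \<le> 0 \<or> (b - x) / \<delta> \<le> 0"
    by (auto intro: divide_nonpos_pos)
  then have "min 1 (min ((x - a) / \<delta>) ((b - x) / \<delta>)) \<le> 0"
    by (auto simp: min_le_iff_disj)
  then show ?thesis
    unfolding trapezoid_def by (rule max_absorb1)
qed

lemma trapezoid_inside: "\<delta> > 0 \<Longrightarrow> a + \<delta> \<le> x \<Longrightarrow> x \<le> b - \<delta> \<Longrightarrow> trapezoid \<delta> a b x = 1"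
  by (auto simp: trapezoid_def max_def min_def field_simps)

lemma has_integral_indicator_Icc:
  fixes a b :: real
  assumes "0 \<le> a" "a \<le> b" "b \<le> 1"
  shows "((\<lambda>x. if x \<in> {a..b} then 1 else 0 :: real) has_integral b - a) {0..1}"
  using assms has_integral_const_real[of "1::real" a b] by (subst has_integral_restrict) auto

lemma integral_trapezoid:
  assumes "\<delta> > 0" "0 \<le> a" "a \<le> b" "b \<le> 1"
  shows "integral {0..1} (trapezoid \<delta> a b) \<le> b - a"
    and "integral {0..1} (trapezoid \<delta> a b) \<ge> b - a - 2 * \<delta>"
proof -
  have int: "(trapezoid \<delta> a b has_integral integral {0..1} (trapezoid \<delta> a b)) {0..1}"
    using assms by (intro integrable_integral integrable_continuous_real continuous_on_trapezoid)
  show "integral {0..1} (trapezoid \<delta> a b) \<le> b - a"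
    using assms trapezoid_outside[of \<delta> _ a b] trapezoid_le_1[of \<delta> a b]
    by (intro has_integral_le[OF int has_integral_indicator_Icc[of a b]]) auto
  show "integral {0..1} (trapezoid \<delta> a b) \<ge> b - a - 2 * \<delta>"
  proof (cases "a + \<delta> \<le> b - \<delta>")
    case True
    then have "(b - \<delta>) - (a + \<delta>) \<le> integral {0..1} (trapezoid \<delta> a b)"
      using assms trapezoid_inside[of \<delta> a _ b] trapezoid_nonneg[of \<delta> a b]
      by (intro has_integral_le[OF has_integral_indicator_Icc[of "a + \<delta>" "b - \<delta>"] int]) auto
    then show ?thesis by simp
  next
    case False
    then show ?thesis
      using has_integral_nonneg[OF int] trapezoid_nonneg[of \<delta> a b] by auto
  qed
qed

text \<open>The indicator of \<open>[a, b)\<close> is squeezed between the trapezoid on \<open>[a, b)\<close> and one minus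
  those on the complementary intervals; the gap is continuous and periodic.\<close>

lemma weyl_interval:
  fixes w :: "nat \<Rightarrow> complex"
  assumes bound: "\<And>n. norm (w n) \<le> 1"
    and mz1: "\<And>j. j \<noteq> 0 \<Longrightarrow> mean_zero (\<lambda>n. cis2pi (of_int j * x n))"
    and mz: "\<And>j. j \<noteq> 0 \<Longrightarrow> mean_zero (\<lambda>n. cis2pi (of_int j * x n) * w n)"
    and ab: "0 \<le> a" "a < b" "b \<le> 1"
  shows "mean_zero (\<lambda>n. of_real (indicator {a..<b} (frac (x n)) - (b - a)) * w n)"
proof (rule mean_zero_approx)
  fix \<epsilon> :: real assume "\<epsilon> > 0"
  \<comment> \<open>Each of the three trapezoids in \<open>q\<close> loses at most 2 \<delta> of its
    integral, and replacing b - a by \<open>I\<close> costs another 2 \<delta>; together 8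
    \<delta>.\<close>
  define \<delta> where "\<delta> = \<epsilon> / 8"
  have "\<delta> > 0" using \<open>\<epsilon> > 0\<close> by (simp add: \<delta>_def)
  let ?t = "trapezoid \<delta>"
  define I where "I = integral {0..1} (?t a b)"
  define q where "q x = 1 - ?t 0 a x - ?t a b x - ?t b 1 x" for x
  define J where "J = integral {0..1} q"
  have intg: "?t u v integrable_on {0..1}" for u v
    by (intro integrable_continuous_real continuous_on_trapezoid \<open>\<delta> > 0\<close>)
  have "J = 1 - integral {0..1} (?t 0 a) - I - integral {0..1} (?t b 1)"
    unfolding J_def q_def I_def
    by (subst integral_diff, intro integrable_diff intg integrable_const_ivl, rule intg,
        subst integral_diff, intro integrable_diff intg integrable_const_ivl, rule intg,
        subst integral_diff, rule integrable_const_ivl, rule intg) simp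
  then have J: "J \<le> 6 * \<delta>"
    using integral_trapezoid(2)[OF \<open>\<delta> > 0\<close>, of 0 a] integral_trapezoid(2)[OF \<open>\<delta> > 0\<close>, of a b]
      integral_trapezoid(2)[OF \<open>\<delta> > 0\<close>, of b 1] ab by (simp add: I_def)
  have I: "\<bar>b - a - I\<bar> \<le> 2 * \<delta>"
    using integral_trapezoid[OF \<open>\<delta> > 0\<close>, of a b] ab by (simp add: I_def)
  have ends: "?t u v 0 = 0" "?t u v 1 = 0" if "0 \<le> u" "v \<le> 1" for u v
    using that \<open>\<delta> > 0\<close> by (simp_all add: trapezoid_outside)
  \<comment> \<open>The error is estimated in absolute value, where the weight is bounded by 1; its
    mean therefore rests on the unweighted hypothesis \<open>mz1\<close>.\<close>
  have mean_q: "mean_zero (\<lambda>n. of_real (q (frac (x n)) - J) * 1)"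
    unfolding J_def using mz1 \<open>\<delta> > 0\<close> ab
    by (intro weyl_continuous)
       (auto simp: q_def ends intro!: continuous_intros continuous_on_trapezoid)
  have "mean_zero (\<lambda>n. of_real (?t a b (frac (x n)) - I) * w n)"
    unfolding I_def using mz ab \<open>\<delta> > 0\<close> bound
    by (intro weyl_continuous) (auto simp: ends intro!: continuous_on_trapezoid)
  moreover have "norm (of_real (indicator {a..<b} (frac (x n)) - (b - a)) * w n
      - of_real (?t a b (frac (x n)) - I) * w n) \<le> q (frac (x n)) + 2 * \<delta>" for n
  proof -
    define y where "y = frac (x n)"
    have y: "0 \<le> y" "y < 1" by (simp_all add: y_def frac_lt_1)
    have "\<bar>indicator {a..<b} y - ?t a b y\<bar> \<le> q y"
    proof -
      consider "y < a" | "a \<le> y" "y < b" | "b \<le> y" by linarith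
      then show ?thesis
        using trapezoid_le_1[of \<delta> 0 a y] trapezoid_le_1[of \<delta> b 1 y] trapezoid_le_1[of \<delta> a b y] ab
        by cases (simp_all add: q_def trapezoid_outside[OF \<open>\<delta> > 0\<close>])
    qed
    then have le: "\<bar>(indicator {a..<b} y - ?t a b y) - (b - a - I)\<bar> \<le> q y + 2 * \<delta>"
      using I by linarith
    have "of_real (indicator {a..<b} y - (b - a)) * w n - of_real (?t a b y - I) * w n
        = of_real ((indicator {a..<b} y - ?t a b y) - (b - a - I)) * w n"
      by (simp add: algebra_simps)
    also have "norm \<dots> \<le> (q y + 2 * \<delta>) * 1"
      unfolding norm_mult norm_of_real using le bound[of n] by (intro mult_mono) auto
    finally show ?thesis by (simp add: y_def)
  qed
  moreover have "J + 2 * \<delta> \<le> \<epsilon>" using J by (simp add: \<delta>_def)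
  moreover have "(\<lambda>n. complex_of_real (q (frac (x n)) + 2 * \<delta> - (J + 2 * \<delta>)))
      = (\<lambda>n. of_real (q (frac (x n)) - J) * 1)" by simp
  ultimately show "\<exists>g (q :: nat \<Rightarrow> real) c. c \<le> \<epsilon> \<and> mean_zero g \<and>
      mean_zero (\<lambda>n. of_real (q n - c)) \<and>
      (\<forall>n. norm (of_real (indicator {a..<b} (frac (x n)) - (b - a)) * w n - g n) \<le> q n)"
    using mean_q
    by (intro exI[of _ "\<lambda>n. of_real (?t a b (frac (x n)) - I) * w n"]
        exI[of _ "\<lambda>n. q (frac (x n)) + 2 * \<delta>"] exI[of _ "J + 2 * \<delta>"]) metis
qed

section \<open>Bracket quadratic phases\<close>

lemma rational_mult_irrational_notin_Ints:
  fixes x r :: real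
  assumes "x \<notin> \<rat>" "r \<in> \<rat>" "r \<noteq> 0"
  shows "r * x \<notin> \<int>"
proof
  assume "r * x \<in> \<int>"
  then have "r * x / r \<in> \<rat>"
    using assms(2) Ints_subset_Rats by (intro Rats_divide) auto
  with assms show False by simp
qed

text \<open>Weyl's criterion for the rotation by \<beta> with the linear phase of \<theta> as
  weight. The frequencies that arise are j \<beta> + \<theta>, and the independence assumption keeps
  all of them, also for j = 0, away from the integers.\<close>

lemma mean_zero_interval_phase:
  assumes indep: "\<And>p q :: int. \<theta> \<noteq> of_int p + of_int q * \<beta>" and "\<beta> \<notin> \<rat>"
  shows "mean_zero (\<lambda>n. of_real (indicator {a..<b} (frac (real n * \<beta> + s))) * cis2pi (real n * \<theta>))"
    (is "mean_zero (?f a b)")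
proof -
  have *: "mean_zero (?f a b)" if ab: "0 \<le> a" "a < b" "b \<le> 1" for a b
  proof -
    have lin: "mean_zero (\<lambda>n. cis2pi (real n * (of_int j * \<beta> + t)))"
      if "of_int j * \<beta> + t \<notin> \<int>" for j t
      using that by (rule mean_zero_linear_phase)
    have "mean_zero (\<lambda>n. of_real (indicator {a..<b} (frac (real n * \<beta> + s)) - (b - a))
        * cis2pi (real n * \<theta>))"
    proof (rule weyl_interval[OF _ _ _ ab])
      fix j :: int assume "j \<noteq> 0"
      have "of_int j * \<beta> \<notin> \<int>"
        using \<open>j \<noteq> 0\<close> \<open>\<beta> \<notin> \<rat>\<close> by (intro rational_mult_irrational_notin_Ints) auto
      then have "mean_zero (\<lambda>n. cis2pi (of_int j * s) * cis2pi (real n * (of_int j * \<beta> + 0)))"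
        by (intro mean_zero_mult_left lin) simp
      then show "mean_zero (\<lambda>n. cis2pi (of_int j * (real n * \<beta> + s)))"
        by (simp add: algebra_simps flip: cis2pi_add)
      have "of_int j * \<beta> + \<theta> \<notin> \<int>"
      proof
        assume "of_int j * \<beta> + \<theta> \<in> \<int>"
        then obtain p :: int where "of_int j * \<beta> + \<theta> = of_int p" by (elim Ints_cases)
        then show False using indep[of p "- j"] by simp
      qed
      then have "mean_zero (\<lambda>n. cis2pi (of_int j * s) * cis2pi (real n * (of_int j * \<beta> + \<theta>)))"
        by (intro mean_zero_mult_left lin)
      then show "mean_zero (\<lambda>n. cis2pi (of_int j * (real n * \<beta> + s)) * cis2pi (real n * \<theta>))"
        by (simp add: algebra_simps flip: cis2pi_add)
    qed simp
    moreover have "\<theta> \<notin> \<int>"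
      using indep[of _ 0] by (auto elim!: Ints_cases)
    then have "mean_zero (\<lambda>n. of_real (b - a) * cis2pi (real n * \<theta>))"
      by (intro mean_zero_mult_left mean_zero_linear_phase)
    ultimately have "mean_zero (\<lambda>n. of_real (indicator {a..<b} (frac (real n * \<beta> + s)) - (b - a))
        * cis2pi (real n * \<theta>) + of_real (b - a) * cis2pi (real n * \<theta>))"
      by (rule mean_zero_add)
    then show ?thesis by (simp add: algebra_simps)
  qed
  have "?f a b = ?f (max a 0) (min b 1)"
    by (auto simp: indicator_def frac_lt_1 fun_eq_iff)
  moreover have "mean_zero (?f (max a 0) (min b 1))"
  proof (cases "max a 0 < min b 1")
    case True
    then show ?thesis by (intro *) auto
  next
    case False
    then have "{max a 0..<min b 1} = {}" by (intro atLeastLessThan_empty) linarith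
    then show ?thesis by (simp only: mean_zero_def) simp
  qed
  ultimately show ?thesis by (simp only:)
qed

text \<open>\<open>F\<close> may take different values at 0 and 1, so trigonometric polynomials
  cannot approximate it uniformly. Step functions on intervals of length 1 / M can, and each step is
  a case of \<open>mean_zero_interval_phase\<close>.\<close>

lemma mean_zero_piecewise_continuous_phase:
  fixes F :: "real \<Rightarrow> complex"
  assumes indep: "\<And>p q :: int. \<theta> \<noteq> of_int p + of_int q * \<beta>" and "\<beta> \<notin> \<rat>"
    and F: "continuous_on {0..1} F"
  shows "mean_zero (\<lambda>n. of_real (indicator {a..<b} (frac (real n * \<beta> + s)))
           * F (frac (real n * \<beta> + s)) * cis2pi (real n * \<theta>))"
proof (rule mean_zero_approx)
  fix \<epsilon> :: real assume "\<epsilon> > 0"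
  have "uniformly_continuous_on {0..1} F"
    using F by (intro compact_uniformly_continuous) auto
  then obtain d where "d > 0"
    and d: "\<And>x y. x \<in> {0..1} \<Longrightarrow> y \<in> {0..1} \<Longrightarrow> dist y x < d \<Longrightarrow> dist (F y) (F x) < \<epsilon>"
    using \<open>\<epsilon> > 0\<close> unfolding uniformly_continuous_on_def by metis
  obtain M :: nat where M: "1 / d < real M" using reals_Archimedean2 by blast
  then have "M > 0" using \<open>d > 0\<close> by (auto simp: field_simps intro: gr0I)
  define y where "y n = frac (real n * \<beta> + s)" for n
  define I where "I k = {max a (real k / M) ..< min b (real (Suc k) / M)}" for k
  let ?g = "\<lambda>n. \<Sum>k<M. F (real k / M) * (of_real (indicator (I k) (y n)) * cis2pi (real n * \<theta>))"
  have mz: "mean_zero ?g"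
    unfolding y_def I_def
    by (intro mean_zero_sum mean_zero_mult_left mean_zero_interval_phase indep \<open>\<beta> \<notin> \<rat>\<close>) simp
  have "norm (of_real (indicator {a..<b} (y n)) * F (y n) * cis2pi (real n * \<theta>) - ?g n) \<le> \<epsilon>" for n
  proof -
    have y: "0 \<le> y n" "y n < 1" by (simp_all add: y_def frac_lt_1)
    define k where "k = nat \<lfloor>y n * M\<rfloor>"
    have k: "real k \<le> y n * M" "y n * M < real k + 1"
      using y by (simp_all add: k_def)
    have "y n * real M < 1 * real M"
      using y(2) \<open>M > 0\<close> by (intro mult_strict_right_mono) auto
    then have "k < M" using k(1) by linarith
    have yk: "real i / M \<le> y n \<and> y n < real (Suc i) / M \<longleftrightarrow> i = k" for i
    proof
      assume "real i / M \<le> y n \<and> y n < real (Suc i) / M"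
      then have "real i \<le> y n * M" "y n * M < real i + 1"
        using \<open>M > 0\<close> by (auto simp: field_simps)
      then have "real i < real (Suc k)" "real k < real (Suc i)" using k by auto
      then show "i = k" by linarith
    qed (use k \<open>M > 0\<close> in \<open>auto simp: field_simps\<close>)
    have ind: "indicator (I i) (y n) = (if i = k then indicator {a..<b} (y n) else 0 :: real)" for i
      using yk[of i] by (auto simp: I_def indicator_def)
    have "?g n = F (real k / M) * (of_real (indicator {a..<b} (y n)) * cis2pi (real n * \<theta>))"
      using \<open>k < M\<close> by (subst sum.remove[of _ k]) (auto simp: ind)
    then have "of_real (indicator {a..<b} (y n)) * F (y n) * cis2pi (real n * \<theta>) - ?g n
        = of_real (indicator {a..<b} (y n)) * (F (y n) - F (real k / M)) * cis2pi (real n * \<theta>)"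
      by (simp add: algebra_simps)
    also have "norm \<dots> \<le> 1 * \<epsilon>"
      unfolding norm_mult norm_cis2pi mult_1_right
    proof (rule mult_mono)
      have "\<bar>y n - real k / M\<bar> \<le> 1 / M"
        using yk[of k] by (simp add: add_divide_distrib)
      also have "1 / M < d"
        using M \<open>d > 0\<close> \<open>M > 0\<close> by (simp add: field_simps)
      finally have "dist (y n) (real k / M) < d" by (simp add: dist_real_def)
      moreover have "real k / M \<in> {0..1}" using \<open>k < M\<close> by simp
      ultimately show "norm (F (y n) - F (real k / M)) \<le> \<epsilon>"
        using d[of "real k / M" "y n"] y by (simp add: dist_norm)
    qed (auto simp: indicator_def)
    finally show ?thesis by simp
  qed
  then show "\<exists>g (q :: nat \<Rightarrow> real) c. c \<le> \<epsilon> \<and> mean_zero g \<and> mean_zero (\<lambda>n. of_real (q n - c)) \<and>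
      (\<forall>n. norm (of_real (indicator {a..<b} (frac (real n * \<beta> + s)))
           * F (frac (real n * \<beta> + s)) * cis2pi (real n * \<theta>) - g n) \<le> q n)"
    using mz by (intro exI[of _ ?g] exI[of _ "\<lambda>_. \<epsilon>"] exI[of _ \<epsilon>]) (simp add: mean_zero_def y_def)
qed

lemma floor_add_cases:
  fixes x t :: real
  shows "\<lfloor>x + t\<rfloor> = \<lfloor>x\<rfloor> + (if frac x \<in> {0..<1 - frac t} then \<lfloor>t\<rfloor> else \<lfloor>t\<rfloor> + 1)"
  using frac_ge_0[of x] by (simp add: floor_add not_le)

text \<open>The difference operator turns the phase into a linear one whose frequency takes two values,
  according to the carry in \<open>\<lfloor>n \<beta> + 1 / 2\<rfloor> + \<lfloor>h \<beta>\<rfloor>\<close>. Two shifts with a frequency in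
  \<open>\<int> + \<int> \<beta>\<close> give proportional pairs \<open>(k, h)\<close> with \<open>k\<close> within 1 of \<open>h \<beta>\<close>,
  so there are finitely many such shifts.\<close>

lemma mean_zero_bracket_phase:
  assumes "\<beta> \<notin> \<rat>"
    and indep: "\<And>m p q :: int. m \<noteq> 0 \<Longrightarrow> of_int m * \<mu> \<noteq> of_int p + of_int q * \<beta>"
  shows "mean_zero (\<lambda>n. cis2pi (\<kappa> * (real n)\<^sup>2 + \<delta> * real n + \<mu> * real n * of_int \<lfloor>real n * \<beta> + 1 / 2\<rfloor>))"
proof -
  define x where "x n = real n * \<beta> + 1 / 2" for n
  define \<psi> where "\<psi> n = \<kappa> * (real n)\<^sup>2 + \<delta> * real n + \<mu> * real n * of_int \<lfloor>x n\<rfloor>" for n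
  define \<theta> where "\<theta> h k = 2 * \<kappa> * real h + \<mu> * of_int k + \<mu> * real h * \<beta>" for h and k :: int
  define E where "E = {h. h \<ge> 1 \<and> (\<exists>k\<in>{\<lfloor>real h * \<beta>\<rfloor>, \<lfloor>real h * \<beta>\<rfloor> + 1}. \<exists>p q :: int.
      \<theta> h k = of_int p + of_int q * \<beta>)}"
  have "finite E"
  proof (cases "E = {}")
    case False
    then obtain h\<^sub>0 where "h\<^sub>0 \<in> E" by blast
    then obtain k\<^sub>0 p\<^sub>0 q\<^sub>0 :: int where "h\<^sub>0 \<ge> 1"
      and \<theta>\<^sub>0: "\<theta> h\<^sub>0 k\<^sub>0 = of_int p\<^sub>0 + of_int q\<^sub>0 * \<beta>"
      by (auto simp: E_def)
    have nz: "of_int k\<^sub>0 \<noteq> real h\<^sub>0 * \<beta>"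
    proof
      assume "of_int k\<^sub>0 = real h\<^sub>0 * \<beta>"
      then have "\<beta> = of_int k\<^sub>0 / real h\<^sub>0" using \<open>h\<^sub>0 \<ge> 1\<close> by (simp add: field_simps)
      then show False using \<open>\<beta> \<notin> \<rat>\<close> by (metis Rats_divide Rats_of_int Rats_of_nat)
    qed
    \<comment> \<open>Proportionality of (k, h) to (\<open>k\<^sub>0\<close>,
      \<open>h\<^sub>0\<close>) gives h |\<open>k\<^sub>0\<close> - \<open>h\<^sub>0\<close>
      \<beta>| = \<open>h\<^sub>0\<close> |k - h \<beta>|, and the right-hand side is at most
      \<open>h\<^sub>0\<close>.\<close>
    define B where "B = real h\<^sub>0 / \<bar>of_int k\<^sub>0 - real h\<^sub>0 * \<beta>\<bar>"
    have "real h \<le> B" if hE: "h \<in> E" for h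
    proof -
      obtain k p q :: int where k: "k \<in> {\<lfloor>real h * \<beta>\<rfloor>, \<lfloor>real h * \<beta>\<rfloor> + 1}"
        and \<theta>: "\<theta> h k = of_int p + of_int q * \<beta>"
        using hE unfolding E_def mem_Collect_eq by (elim conjE bexE exE)
      \<comment> \<open>Cross-multiplication cancels 2 \<kappa> h and \<mu> h \<beta>, both
        proportional to h. So the unknown \<kappa> disappears, and what remains is an integer
        multiple of \<mu>.\<close>
      have "of_int (int h\<^sub>0 * k - int h * k\<^sub>0) * \<mu> = real h\<^sub>0 * \<theta> h k - real h * \<theta> h\<^sub>0 k\<^sub>0"
        by (simp add: \<theta>_def algebra_simps)
      also have "\<dots> = of_int (int h\<^sub>0 * p - int h * p\<^sub>0) + of_int (int h\<^sub>0 * q - int h * q\<^sub>0) * \<beta>"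
        by (simp add: \<theta> \<theta>\<^sub>0 algebra_simps)
      finally have "int h\<^sub>0 * k - int h * k\<^sub>0 = 0"
        using indep[of "int h\<^sub>0 * k - int h * k\<^sub>0" "int h\<^sub>0 * p - int h * p\<^sub>0"
            "int h\<^sub>0 * q - int h * q\<^sub>0"] by blast
      then have "int h\<^sub>0 * k = int h * k\<^sub>0" by simp
      then have eq: "real h\<^sub>0 * of_int k = real h * of_int k\<^sub>0"
        by (metis of_int_mult of_int_of_nat_eq)
      have "\<bar>of_int k - real h * \<beta>\<bar> \<le> 1"
        using k by (auto simp: abs_if) linarith+
      then have "real h\<^sub>0 * \<bar>of_int k - real h * \<beta>\<bar> \<le> real h\<^sub>0 * 1"
        by (intro mult_left_mono) auto
      also have "real h\<^sub>0 * \<bar>of_int k - real h * \<beta>\<bar> = \<bar>real h\<^sub>0 * (of_int k - real h * \<beta>)\<bar>"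
        by (simp add: abs_mult)
      also have "real h\<^sub>0 * (of_int k - real h * \<beta>) = real h * (of_int k\<^sub>0 - real h\<^sub>0 * \<beta>)"
        by (simp add: right_diff_distrib eq)
      finally have "real h * \<bar>of_int k\<^sub>0 - real h\<^sub>0 * \<beta>\<bar> \<le> real h\<^sub>0"
        by (simp add: abs_mult)
      then show ?thesis
        using nz by (simp add: B_def pos_le_divide_eq)
    qed
    then have "E \<subseteq> {..nat \<lfloor>B\<rfloor>}" by (auto intro: le_nat_floor)
    then show ?thesis by (rule finite_subset) simp
  qed simp
  have "mean_zero (\<lambda>n. cis2pi (\<psi> n))"
  proof (rule van_der_corput[OF _ \<open>finite E\<close>])
    fix h :: nat assume "h \<ge> 1" "h \<notin> E"
    define c where "c = \<lfloor>real h * \<beta>\<rfloor>"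
    define t where "t = frac (real h * \<beta>)"
    \<comment> \<open>Writing \<lfloor>x n\<rfloor> as n \<beta> + 1 / 2 - y, where y is the
      fractional part, removes the bracket from the difference of the phases: the terms linear in n
      combine to n times \<open>\<theta> h k\<close>, and \<open>F k y\<close> collects the
      rest.\<close>
    define F where "F k y = cis2pi (\<kappa> * (real h)\<^sup>2 + \<delta> * real h + \<mu> * real h * of_int k
        + \<mu> * real h / 2 - \<mu> * real h * y)" for k :: int and y
    have ne: "\<theta> h k \<noteq> of_int p + of_int q * \<beta>" if "k = c \<or> k = c + 1" for k p q :: int
      using \<open>h \<ge> 1\<close> \<open>h \<notin> E\<close> that by (auto simp: E_def c_def)
    have "cis2pi (\<psi> (n + h)) * cnj (cis2pi (\<psi> n))
      = of_real (indicator {0..<1 - t} (frac (real n * \<beta> + 1 / 2)))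
          * F c (frac (real n * \<beta> + 1 / 2)) * cis2pi (real n * \<theta> h c)
      + of_real (indicator {1 - t..<1} (frac (real n * \<beta> + 1 / 2)))
          * F (c + 1) (frac (real n * \<beta> + 1 / 2)) * cis2pi (real n * \<theta> h (c + 1))" for n
    proof -
      define y where "y = frac (x n)"
      have y: "0 \<le> y" "y < 1" by (simp_all add: y_def frac_lt_1)
      define k where "k = (if y \<in> {0..<1 - t} then c else c + 1)"
      have shift: "\<lfloor>x (n + h)\<rfloor> = \<lfloor>x n\<rfloor> + k"
      proof -
        have "x (n + h) = x n + real h * \<beta>" by (simp add: x_def algebra_simps)
        then show ?thesis
          by (simp only: floor_add_cases k_def y_def c_def t_def)
      qed
      have fl: "real_of_int \<lfloor>x n\<rfloor> = real n * \<beta> + 1 / 2 - y"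
        by (simp add: y_def frac_def x_def)
      have "\<psi> (n + h) - \<psi> n = (\<kappa> * (real h)\<^sup>2 + \<delta> * real h + \<mu> * real h * of_int k
        + \<mu> * real h / 2 - \<mu> * real h * y) + real n * \<theta> h k"
        unfolding \<psi>_def shift \<theta>_def of_int_add fl by (simp add: algebra_simps power2_eq_square)
      then have "cis2pi (\<psi> (n + h)) * cnj (cis2pi (\<psi> n)) = F k y * cis2pi (real n * \<theta> h k)"
        unfolding cnj_cis2pi F_def by (simp flip: cis2pi_add)
      then show ?thesis
        using y unfolding x_def[symmetric] y_def[symmetric] by (auto simp: k_def indicator_def)
    qed
    moreover have cont: "continuous_on {0..1} (F k)" for k
      unfolding F_def by (intro continuous_intros)
    ultimately show "mean_zero (\<lambda>n. cis2pi (\<psi> (n + h)) * cnj (cis2pi (\<psi> n)))"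
      using ne \<open>\<beta> \<notin> \<rat>\<close>
      by (simp only:) (intro mean_zero_add mean_zero_piecewise_continuous_phase, auto)
  qed simp
  then show ?thesis by (simp add: \<psi>_def x_def)
qed

text \<open>For irrational \<gamma> every difference is linear with irrational frequency 2 h
  \<gamma>. For \<gamma> with denominator q, a shift by q changes the quadratic term by an integer,
  so the sequence is an eigenfunction with eigenvalue
  \<open>cis2pi (real q * \<delta>)\<close>.\<close>

lemma mean_zero_quadratic_phase:
  assumes irr: "\<gamma> \<notin> \<rat> \<or> \<delta> \<notin> \<rat>"
  shows "mean_zero (\<lambda>n. cis2pi ((real n)\<^sup>2 * \<gamma> + real n * \<delta>))"
proof (cases "\<gamma> \<in> \<rat>")
  case False
  show ?thesis
  proof (rule van_der_corput[of _ "{}"])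
    fix h :: nat assume "h \<ge> 1"
    have "2 * real h * \<gamma> \<notin> \<int>"
      using \<open>h \<ge> 1\<close> False by (intro rational_mult_irrational_notin_Ints) auto
    then have "mean_zero (\<lambda>n. cis2pi ((real h)\<^sup>2 * \<gamma> + real h * \<delta>) * cis2pi (real n * (2 * real h * \<gamma>)))"
      by (intro mean_zero_mult_left mean_zero_linear_phase)
    also have "(\<lambda>n. cis2pi ((real h)\<^sup>2 * \<gamma> + real h * \<delta>) * cis2pi (real n * (2 * real h * \<gamma>)))
        = (\<lambda>n. cis2pi ((real (n + h))\<^sup>2 * \<gamma> + real (n + h) * \<delta>)
            * cnj (cis2pi ((real n)\<^sup>2 * \<gamma> + real n * \<delta>)))"
      by (simp add: cnj_cis2pi power2_eq_square algebra_simps flip: cis2pi_add)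
    finally show "mean_zero \<dots>" .
  qed auto
next
  case True
  then obtain a b :: int where b: "b > 0" "\<gamma> = of_int a / of_int b"
    by (elim Rats_cases') auto
  define q where "q = nat b"
  have q: "q > 0" "real q * \<gamma> = of_int a" using b by (simp_all add: q_def)
  have "\<delta> \<notin> \<rat>" using irr True by simp
  have "real q * \<delta> \<notin> \<int>"
    using q(1) \<open>\<delta> \<notin> \<rat>\<close> by (intro rational_mult_irrational_notin_Ints) auto
  show ?thesis
  proof (rule mean_zero_eigenfunction[where B = 1])
    show "cis2pi (real q * \<delta>) \<noteq> 1" using \<open>real q * \<delta> \<notin> \<int>\<close> by (simp add: cis2pi_eq_1_iff)
    fix n
    have "(real (n + q))\<^sup>2 * \<gamma> + real (n + q) * \<delta> - (real q * \<delta> + ((real n)\<^sup>2 * \<gamma> + real n * \<delta>))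
        = (2 * real n + real q) * (real q * \<gamma>)"
      by (simp add: power2_eq_square algebra_simps)
    also have "\<dots> \<in> \<int>" unfolding q(2) by (intro Ints_mult Ints_add) auto
    finally have "cis2pi ((real (n + q))\<^sup>2 * \<gamma> + real (n + q) * \<delta>)
        = cis2pi (real q * \<delta> + ((real n)\<^sup>2 * \<gamma> + real n * \<delta>))"
      by (rule cis2pi_cong_Ints)
    then show "cis2pi ((real (n + q))\<^sup>2 * \<gamma> + real (n + q) * \<delta>)
        = cis2pi (real q * \<delta>) * cis2pi ((real n)\<^sup>2 * \<gamma> + real n * \<delta>)"
      by (simp only: cis2pi_add)
  qed simp
qed

section \<open>The set of times\<close>

definition heis_phase :: "real \<Rightarrow> real \<Rightarrow> nat \<Rightarrow> real" where
  "heis_phase \<alpha> \<beta> n = (real n)\<^sup>2 * \<alpha> * \<beta> - 2 * real n * \<alpha> * of_int \<lfloor>real n * \<beta> + 1 / 2\<rfloor>"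

definition heis_set :: "real \<Rightarrow> real \<Rightarrow> nat set" where
  "heis_set \<alpha> \<beta> = {n. frac (heis_phase \<alpha> \<beta> n) \<in> {1/4..<3/4}}"

lemma zero_notin_heis_set: "0 \<notin> heis_set \<alpha> \<beta>"
  by (simp add: heis_set_def heis_phase_def)

text \<open>The polynomial is absorbed by the free coefficients of
  \<open>mean_zero_bracket_phase\<close>, with \<kappa> = k \<alpha> \<beta> + \<gamma>. The bracket
  coefficient \<mu> = -2 k \<alpha> inherits the independence from \<alpha>.\<close>

lemma mean_zero_heis_phase:
  assumes "\<beta> \<notin> \<rat>"
    and indep: "\<And>m p q :: int. m \<noteq> 0 \<Longrightarrow> of_int m * \<alpha> \<noteq> of_int p + of_int q * \<beta>"
    and "k \<noteq> 0"
  shows "mean_zero (\<lambda>n. cis2pi (of_int k * heis_phase \<alpha> \<beta> n) * cis2pi ((real n)\<^sup>2 * \<gamma> + real n * \<delta>))"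
proof -
  have "of_int m * (- 2 * of_int k * \<alpha>) \<noteq> of_int p + of_int q * \<beta>" if "m \<noteq> 0" for m p q :: int
    using indep[of "- 2 * m * k" p q] that \<open>k \<noteq> 0\<close> by (simp add: mult_ac)
  from mean_zero_bracket_phase[OF \<open>\<beta> \<notin> \<rat>\<close> this, of "of_int k * \<alpha> * \<beta> + \<gamma>" \<delta>]
  have "mean_zero (\<lambda>n. cis2pi ((of_int k * \<alpha> * \<beta> + \<gamma>) * (real n)\<^sup>2 + \<delta> * real n
      + (- 2 * of_int k * \<alpha>) * real n * of_int \<lfloor>real n * \<beta> + 1 / 2\<rfloor>))" by blast
  moreover have "(\<lambda>n. cis2pi ((of_int k * \<alpha> * \<beta> + \<gamma>) * (real n)\<^sup>2 + \<delta> * real n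
      + (- 2 * of_int k * \<alpha>) * real n * of_int \<lfloor>real n * \<beta> + 1 / 2\<rfloor>))
    = (\<lambda>n. cis2pi (of_int k * heis_phase \<alpha> \<beta> n) * cis2pi ((real n)\<^sup>2 * \<gamma> + real n * \<delta>))"
    by (simp add: heis_phase_def algebra_simps flip: cis2pi_add)
  ultimately show ?thesis by simp
qed

context
  fixes \<alpha> \<beta> :: real
  assumes irr: "\<beta> \<notin> \<rat>"
    and indep: "\<And>m p q :: int. m \<noteq> 0 \<Longrightarrow> of_int m * \<alpha> \<noteq> of_int p + of_int q * \<beta>"
begin

lemma mean_zero_heis_set_diff:
  "mean_zero (\<lambda>n. of_real (indicator (heis_set \<alpha> \<beta>) n - 1 / 2) * cis2pi ((real n)\<^sup>2 * \<gamma> + real n * \<delta>))"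
proof -
  have "mean_zero (\<lambda>n. cis2pi (of_int k * heis_phase \<alpha> \<beta> n))" if "k \<noteq> 0" for k
    using mean_zero_heis_phase[OF irr indep that, of 0 0] by simp
  then have "mean_zero (\<lambda>n. of_real (indicator {1/4..<3/4} (frac (heis_phase \<alpha> \<beta> n)) - (3/4 - 1/4))
      * cis2pi ((real n)\<^sup>2 * \<gamma> + real n * \<delta>))"
    by (intro weyl_interval mean_zero_heis_phase[OF irr indep]) auto
  then show ?thesis by (simp add: heis_set_def indicator_def)
qed

lemma mean_zero_heis_set_density:
  "mean_zero (\<lambda>n. of_real (indicator (heis_set \<alpha> \<beta>) n - 1 / 2))"
  using mean_zero_heis_set_diff[of 0 0] by simp

text \<open>Split the indicator as (indicator - 1/2) + 1/2: the first part is orthogonal to every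
  quadratic phase, the second reduces to the phase on all integers.\<close>

lemma mean_zero_heis_set_phase:
  assumes "mean_zero (\<lambda>n. cis2pi ((real n)\<^sup>2 * \<gamma> + real n * \<delta>))"
  shows "mean_zero (\<lambda>n. cis2pi ((real n)\<^sup>2 * \<gamma> + real n * \<delta>) * of_real (indicator (heis_set \<alpha> \<beta>) n))"
  using mean_zero_add[OF mean_zero_heis_set_diff[of \<gamma> \<delta>] mean_zero_mult_left[OF assms, of "1/2"]]
  by (simp add: algebra_simps)

lemma heis_set_equidistribution:
  assumes gd: "\<gamma> \<notin> \<rat> \<or> \<delta> \<notin> \<rat>" and ab: "0 \<le> a" "a < b" "b \<le> 1"
  shows "mean_zero (\<lambda>n. of_real
    ((indicator {n. frac ((real n)\<^sup>2 * \<gamma> + real n * \<delta>) \<in> {a..<b}} n - (b - a))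
       * indicator (heis_set \<alpha> \<beta>) n))"
proof -
  have mz: "mean_zero (\<lambda>n. cis2pi ((real n)\<^sup>2 * (of_int j * \<gamma>) + real n * (of_int j * \<delta>)))"
    if "j \<noteq> 0" for j
  proof (rule mean_zero_quadratic_phase)
    have "x \<in> \<rat>" if "of_int j * x \<in> \<rat>" for x :: real
      using Rats_divide[OF that, of "of_int j"] \<open>j \<noteq> 0\<close> by simp
    then show "of_int j * \<gamma> \<notin> \<rat> \<or> of_int j * \<delta> \<notin> \<rat>" using gd by blast
  qed
  have eq: "(real n)\<^sup>2 * (of_int j * \<gamma>) + real n * (of_int j * \<delta>)
      = of_int j * ((real n)\<^sup>2 * \<gamma> + real n * \<delta>)" for n j
    by (simp add: algebra_simps)
  have "mean_zero (\<lambda>n. of_real (indicator {a..<b} (frac ((real n)\<^sup>2 * \<gamma> + real n * \<delta>)) - (b - a))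
      * of_real (indicator (heis_set \<alpha> \<beta>) n))"
    using mz mean_zero_heis_set_phase[OF mz] ab unfolding eq
    by (intro weyl_interval) (auto simp: indicator_def)
  then show ?thesis by (simp add: indicator_def)
qed

text \<open>The indicator of d dvd n is the average of the d characters of the residue classes. The
  trivial one contributes 1 / d; the others are linear phases with non-integral frequency j /
  d.\<close>

lemma heis_set_divisibility:
  assumes "d \<ge> 1"
  shows "mean_zero (\<lambda>n. of_real ((indicator {n. d dvd n} n - 1 / real d) * indicator (heis_set \<alpha> \<beta>) n))"
proof -
  define w where "w n j = cis2pi (real n * (real j / real d))" for n j
  have "mean_zero (\<lambda>n. \<Sum>j\<in>{1..<d}. w n j * of_real (indicator (heis_set \<alpha> \<beta>) n))"
  proof (intro mean_zero_sum)
    fix j assume j: "j \<in> {1..<d}"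
    have "real j / real d \<notin> \<int>"
    proof
      assume "real j / real d \<in> \<int>"
      then obtain k :: int where k: "real j / real d = of_int k" by (elim Ints_cases)
      have "0 < real j / real d" "real j / real d < 1" using j by auto
      then show False unfolding k by simp
    qed
    then show "mean_zero (\<lambda>n. w n j * of_real (indicator (heis_set \<alpha> \<beta>) n))"
      using mean_zero_heis_set_phase[of 0 "real j / real d"] mean_zero_linear_phase[of "real j / real d"]
      by (simp add: w_def)
  qed simp
  then have "mean_zero (\<lambda>n. (1 / of_nat d) * (\<Sum>j\<in>{1..<d}. w n j * of_real (indicator (heis_set \<alpha> \<beta>) n)))"
    by (rule mean_zero_mult_left)
  moreover have "(1 / of_nat d) * (\<Sum>j\<in>{1..<d}. w n j * of_real (indicator (heis_set \<alpha> \<beta>) n))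
      = of_real ((indicator {n. d dvd n} n - 1 / real d) * indicator (heis_set \<alpha> \<beta>) n)" for n
  proof -
    have pow: "w n j = w n 1 ^ j" for j
      unfolding w_def cis2pi_def Complex.DeMoivre by (rule arg_cong[where f = cis]) simp
    have "{..<d} = insert 0 {1..<d}" using \<open>d \<ge> 1\<close> by auto
    then have "(\<Sum>j<d. w n j) = w n 0 + (\<Sum>j\<in>{1..<d}. w n j)"
      by simp
    then have split: "(\<Sum>j\<in>{1..<d}. w n j) = (\<Sum>j<d. w n j) - 1"
      by (simp add: w_def)
    have dvd: "d dvd n \<longleftrightarrow> w n 1 = 1"
    proof
      assume "d dvd n"
      then obtain m where "n = d * m" by blast
      then show "w n 1 = 1" using \<open>d \<ge> 1\<close> by (simp add: w_def cis2pi_eq_1_iff)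
    next
      assume "w n 1 = 1"
      then obtain k :: int where "real n / real d = of_int k"
        by (auto simp: w_def cis2pi_eq_1_iff elim!: Ints_cases)
      then have "real_of_int (int n) = of_int (k * int d)" using \<open>d \<ge> 1\<close> by (simp add: field_simps)
      then have "int n = k * int d" by (simp only: of_int_eq_iff)
      then show "d dvd n" by (metis dvd_triv_right int_dvd_int_iff)
    qed
    have "(\<Sum>j<d. w n j) = (if d dvd n then of_nat d else 0)"
    proof (cases "d dvd n")
      case True
      then have "w n j = 1" for j using pow[of j] dvd by (metis power_one)
      with True show ?thesis by simp
    next
      case False
      have "w n d = 1"
        using \<open>d \<ge> 1\<close> cis2pi_of_int[of "int n"] by (simp add: w_def)
      moreover have "(\<Sum>j<d. w n j) = (\<Sum>j<d. w n 1 ^ j)"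
        by (intro sum.cong refl pow)
      ultimately show ?thesis
        using False dvd pow[of d] by (simp add: geometric_sum)
    qed
    with \<open>d \<ge> 1\<close> split show ?thesis
      unfolding sum_distrib_right[symmetric] by (auto simp: indicator_def field_simps)
  qed
  ultimately show ?thesis by simp
qed

end

section \<open>Relative density along the enumeration of a set\<close>

lemma mean_zero_indicator_diff_iff:
  "mean_zero (\<lambda>n. of_real ((indicator Q n - c) * indicator R n)) \<longleftrightarrow>
   (\<lambda>N. (real (card (R \<inter> Q \<inter> {1..N})) - c * real (card (R \<inter> {1..N}))) / real N) \<longlonglongrightarrow> 0"
proof -
  have sum: "(\<Sum>n=1..N. indicator X n) = real (card (X \<inter> {1..N}))" for X :: "nat set" and N
    by (simp add: indicator_def sum.If_cases Int_commute)
  have "(\<Sum>n=1..N. (indicator Q n - c) * indicator R n)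
      = real (card (R \<inter> Q \<inter> {1..N})) - c * real (card (R \<inter> {1..N}))" for N
  proof -
    have "(\<Sum>n=1..N. (indicator Q n - c) * indicator R n)
        = (\<Sum>n=1..N. indicator (R \<inter> Q) n) - c * (\<Sum>n=1..N. indicator R n)"
      by (simp add: sum_subtractf sum_distrib_left left_diff_distrib indicator_inter_arith mult.commute)
    then show ?thesis by (simp only: sum)
  qed
  then show ?thesis unfolding real_mean_zero_iff by simp
qed

lemma enumerate_pred_image:
  fixes R :: "nat set"
  assumes "infinite R" "0 \<notin> R" "N \<ge> 1"
  shows "R \<inter> {1..enumerate R (N - 1)} = (\<lambda>n. enumerate R (n - 1)) ` {1..N}"
proof (intro set_eqI iffI)
  fix m assume m: "m \<in> R \<inter> {1..enumerate R (N - 1)}"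
  then obtain k where k: "m = enumerate R k" using enumerate_Ex[OF assms(1), of m] by auto
  with m assms have "k \<le> N - 1" by simp
  then show "m \<in> (\<lambda>n. enumerate R (n - 1)) ` {1..N}"
    using k \<open>N \<ge> 1\<close> by (intro image_eqI[of _ _ "Suc k"]) auto
next
  fix m assume "m \<in> (\<lambda>n. enumerate R (n - 1)) ` {1..N}"
  then obtain n where n: "m = enumerate R (n - 1)" "1 \<le> n" "n \<le> N" by auto
  then have "m \<in> R" using enumerate_in_set[OF assms(1)] by simp
  moreover have "m \<noteq> 0" using \<open>m \<in> R\<close> assms(2) by metis
  ultimately show "m \<in> R \<inter> {1..enumerate R (N - 1)}" using n assms by auto
qed

text \<open>With \<open>D\<close> and \<open>S\<close> counting R and its intersection with Q, the
  ratio S / D tends to \<open>c\<close>. Evaluating it at the N-th element of R, where D equals N,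
  gives the frequency among the first N terms.\<close>

lemma relative_density_enumerate:
  fixes R Q :: "nat set"
  assumes "0 \<notin> R" "\<rho> > 0"
    and dens: "mean_zero (\<lambda>n. of_real (indicator R n - \<rho>))"
    and rel: "mean_zero (\<lambda>n. of_real ((indicator Q n - c) * indicator R n))"
  shows "infinite R"
    and "(\<lambda>N. real (card {n \<in> {1..N}. enumerate R (n - 1) \<in> Q}) / real N) \<longlonglongrightarrow> c"
proof -
  define D where "D N = real (card (R \<inter> {1..N}))" for N
  have "(\<lambda>N. (D N - \<rho> * real N) / real N) \<longlonglongrightarrow> 0"
    using mean_zero_indicator_diff_iff[of R \<rho> UNIV] dens by (simp add: D_def Int_commute)
  then have "(\<lambda>N. (D N - \<rho> * real N) / real N + \<rho>) \<longlonglongrightarrow> 0 + \<rho>"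
    by (intro tendsto_intros)
  moreover have "\<forall>\<^sub>F N in sequentially. (D N - \<rho> * real N) / real N + \<rho> = D N / real N"
    using eventually_gt_at_top[of 0] by eventually_elim (simp add: field_simps)
  ultimately have "(\<lambda>N. D N / real N) \<longlonglongrightarrow> 0 + \<rho>"
    by (rule Lim_transform_eventually)
  then have D: "(\<lambda>N. D N / real N) \<longlonglongrightarrow> \<rho>" by simp
  show inf: "infinite R"
  proof
    assume "finite R"
    have "(\<lambda>N. D N / real N) \<longlonglongrightarrow> 0"
    proof (rule tendsto_sandwich[where f = "\<lambda>_. 0" and h = "\<lambda>N. real (card R) / real N"])
      show "\<forall>\<^sub>F N in sequentially. D N / real N \<le> real (card R) / real N"
        using \<open>finite R\<close> by (intro always_eventually allI divide_right_mono)
          (auto simp: D_def intro: card_mono)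
      show "(\<lambda>N. real (card R) / real N) \<longlonglongrightarrow> 0" by (rule lim_const_over_n)
    qed (auto simp: D_def)
    with D \<open>\<rho> > 0\<close> show False using LIMSEQ_unique by fastforce
  qed
  define S where "S N = real (card (R \<inter> Q \<inter> {1..N}))" for N
  have "(\<lambda>N. (S N - c * D N) / real N) \<longlonglongrightarrow> 0"
    using mean_zero_indicator_diff_iff[of Q c R] rel by (simp add: D_def S_def)
  then have "(\<lambda>N. (S N - c * D N) / real N / (D N / real N) + c) \<longlonglongrightarrow> 0 / \<rho> + c"
    using D \<open>\<rho> > 0\<close> by (intro tendsto_intros) auto
  moreover have "\<forall>\<^sub>F N in sequentially.
      (S N - c * D N) / real N / (D N / real N) + c = S N / D N"
    using eventually_gt_at_top[of 0] order_tendstoD(1)[OF D \<open>\<rho> > 0\<close>]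
    by eventually_elim (auto simp: field_simps)
  ultimately have "(\<lambda>N. S N / D N) \<longlonglongrightarrow> 0 / \<rho> + c"
    by (rule Lim_transform_eventually)
  then have SD: "(\<lambda>N. S N / D N) \<longlonglongrightarrow> c" by simp
  let ?r = "\<lambda>n. enumerate R (n - 1)"
  have "filterlim ?r at_top sequentially"
  proof (rule filterlim_at_top_mono)
    show "filterlim (\<lambda>n::nat. n - 1) at_top sequentially"
      by (rule filterlim_minus_const_nat_at_top)
    show "\<forall>\<^sub>F n in sequentially. n - 1 \<le> ?r n"
      using le_enumerate[OF inf] by simp
  qed
  with SD have "(\<lambda>N. S (?r N) / D (?r N)) \<longlonglongrightarrow> c"
    by (rule filterlim_compose)
  moreover have "\<forall>\<^sub>F N in sequentially.
      S (?r N) / D (?r N) = real (card {n \<in> {1..N}. ?r n \<in> Q}) / real N"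
    using eventually_ge_at_top[of 1]
  proof eventually_elim
    case (elim N)
    have inj: "inj_on ?r A" if "A \<subseteq> {1..N}" for A
    proof (rule inj_onI)
      fix m n assume "m \<in> A" "n \<in> A" "?r m = ?r n"
      then have "m - 1 = n - 1" "m \<ge> 1" "n \<ge> 1" using inj_enumerate[OF inf] that by (auto dest: injD)
      then show "m = n" by simp
    qed
    note img = enumerate_pred_image[OF inf \<open>0 \<notin> R\<close> elim]
    have "R \<inter> Q \<inter> {1..?r N} = (?r ` {1..N}) \<inter> Q" unfolding img[symmetric] by blast
    also have "\<dots> = ?r ` {n \<in> {1..N}. ?r n \<in> Q}" by blast
    finally have SQ: "R \<inter> Q \<inter> {1..?r N} = ?r ` {n \<in> {1..N}. ?r n \<in> Q}" .
    have "S (?r N) = real (card {n \<in> {1..N}. ?r n \<in> Q})"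
      unfolding S_def SQ by (subst card_image[OF inj]) auto
    moreover have "D (?r N) = real N"
      unfolding D_def img using card_image[OF inj, of "{1..N}"] by simp
    ultimately show ?case by simp
  qed
  ultimately show "(\<lambda>N. real (card {n \<in> {1..N}. ?r n \<in> Q}) / real N) \<longlonglongrightarrow> c"
    by (rule Lim_transform_eventually)
qed

lemma has_positive_density_of_nat:
  assumes "(\<lambda>N. real (card {n \<in> {1..N}. P n}) / real N) \<longlonglongrightarrow> c" "c > 0"
  shows "has_positive_density {int n | n. n \<ge> 1 \<and> P n}"
  unfolding has_positive_density_def
proof (intro exI conjI)
  \<comment> \<open>The density is taken in the symmetric window {-N..N}, of which the positive half
    makes up only a proportion tending to 1/2.\<close>
  show "c * (1 / 2) > 0" using assms by simp
  have card: "card ({int n | n. n \<ge> 1 \<and> P n} \<inter> {- int N..int N}) = card {n \<in> {1..N}. P n}" for N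
  proof -
    have "{int n | n. n \<ge> 1 \<and> P n} \<inter> {- int N..int N} = int ` {n \<in> {1..N}. P n}" by auto
    then show ?thesis by (simp add: card_image)
  qed
  have "(\<lambda>N. real N / (2 * real N + 1)) \<longlonglongrightarrow> 1 / 2" by real_asymp
  with assms(1) have "(\<lambda>N. real (card {n \<in> {1..N}. P n}) / real N * (real N / (2 * real N + 1)))
      \<longlonglongrightarrow> c * (1 / 2)"
    by (intro tendsto_mult)
  moreover have "\<forall>\<^sub>F N in sequentially.
      real (card {n \<in> {1..N}. P n}) / real N * (real N / (2 * real N + 1))
        = real (card ({int n | n. n \<ge> 1 \<and> P n} \<inter> {- int N..int N})) / (2 * real N + 1)"
    using eventually_gt_at_top[of 0] by eventually_elim (simp only: card, simp)
  ultimately show "(\<lambda>N. real (card ({int n | n. n \<ge> 1 \<and> P n} \<inter> {- int N..int N})) / (2 * real N + 1))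
      \<longlonglongrightarrow> c * (1 / 2)"
    by (rule Lim_transform_eventually)
qed

section \<open>The Heisenberg system\<close>

text \<open>The circle rotation by \<open>t\<close>, performed inside each interval [k, k + 1)
  separately. Keeping \<lfloor>x\<rfloor> makes it a bijection of the whole line.\<close>

definition unit_rot :: "real \<Rightarrow> real \<Rightarrow> real" where
  "unit_rot t x = of_int \<lfloor>x\<rfloor> + frac (x + t)"

lemma floor_unit_rot [simp]: "\<lfloor>unit_rot t x\<rfloor> = \<lfloor>x\<rfloor>"
  using frac_ge_0[of "x + t"] frac_lt_1[of "x + t"] unfolding unit_rot_def by linarith

lemma unit_rot_0 [simp]: "unit_rot 0 x = x"
  by (simp add: unit_rot_def frac_def)

lemma unit_rot_unit_rot: "unit_rot s (unit_rot t x) = unit_rot (s + t) x"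
proof -
  have "unit_rot t x + s = of_int (\<lfloor>x\<rfloor> - \<lfloor>x + t\<rfloor>) + (x + (s + t))"
    by (simp add: unit_rot_def frac_def)
  then have "frac (unit_rot t x + s) = frac (x + (s + t))"
    by (metis Ints_of_int add.commute frac_add_int_right)
  then show ?thesis by (simp add: unit_rot_def[of s] unit_rot_def[of "s + t"])
qed

lemma unit_rot_measurable [measurable]:
  assumes [measurable]: "f \<in> borel_measurable M" "g \<in> borel_measurable M"
  shows "(\<lambda>x. unit_rot (f x) (g x)) \<in> borel_measurable M"
  unfolding unit_rot_def frac_def by measurable

text \<open>The mass sits on [0, 1), but the space is the full line, so that products have exactly
  the Borel sets of a Euclidean space, as \<open>transported_system\<close> requires.\<close>

definition unit_measure :: "real measure" where
  "unit_measure = uniform_measure lborel {0..<1}"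

lemma sets_unit_measure [measurable_cong, simp]: "sets unit_measure = sets borel"
  by (simp add: unit_measure_def)

lemma space_unit_measure [simp]: "space unit_measure = UNIV"
  by (simp add: unit_measure_def)

lemma emeasure_unit_measure:
  "A \<in> sets borel \<Longrightarrow> emeasure unit_measure A = emeasure lborel ({0..<1} \<inter> A)"
  by (simp add: unit_measure_def divide_ennreal_def)

interpretation unit: prob_space unit_measure
  unfolding unit_measure_def by (rule prob_space_uniform_measure) simp_all

lemma emeasure_lborel_vimage_plus:
  fixes c :: real
  assumes "A \<in> sets borel"
  shows "emeasure lborel ((+) c -` A) = emeasure lborel A"
proof -
  have "emeasure lborel A = emeasure (distr lborel borel ((+) c)) A"
    by (simp add: lborel_distr_plus)
  also have "\<dots> = emeasure lborel ((+) c -` A)"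
    using assms by (subst emeasure_distr) auto
  finally show ?thesis by simp
qed

lemma emeasure_vimage_unit_rot:
  assumes A [measurable]: "A \<in> sets borel"
  shows "emeasure unit_measure (unit_rot t -` A) = emeasure unit_measure A"
proof -
  define s where "s = frac t"
  have s: "0 \<le> s" "s < 1" by (simp_all add: s_def frac_lt_1)
  have rot: "unit_rot t x = (if x < 1 - s then s + x else (s - 1) + x)" if "0 \<le> x" "x < 1" for x
  proof -
    have "\<lfloor>x\<rfloor> = 0" "frac x = x" using that by (auto simp: floor_eq_iff frac_eq)
    then show ?thesis by (simp add: unit_rot_def frac_add s_def)
  qed
  have vimage: "unit_rot t -` A \<in> sets borel"
    using measurable_sets[of "unit_rot t" borel borel A] by simp
  \<comment> \<open>On [0, 1) the rotation exchanges two intervals, each moved by a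
    translation.\<close>
  have "{0..<1} \<inter> unit_rot t -` A = (+) s -` ({s..<1} \<inter> A) \<union> (+) (s - 1) -` ({0..<s} \<inter> A)"
    using s by (auto simp: rot split: if_splits)
  moreover have "(+) s -` ({s..<1} \<inter> A) \<inter> (+) (s - 1) -` ({0..<s} \<inter> A) = {}"
    by auto
  ultimately have "emeasure lborel ({0..<1} \<inter> unit_rot t -` A)
      = emeasure lborel ((+) s -` ({s..<1} \<inter> A)) + emeasure lborel ((+) (s - 1) -` ({0..<s} \<inter> A))"
    by (simp add: plus_emeasure measurable_sets_borel[of _ borel])
  also have "\<dots> = emeasure lborel ({s..<1} \<inter> A) + emeasure lborel ({0..<s} \<inter> A)"
    by (intro arg_cong2[where f = plus] emeasure_lborel_vimage_plus) simp_all
  also have "\<dots> = emeasure lborel (({s..<1} \<inter> A) \<union> ({0..<s} \<inter> A))"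
    by (intro plus_emeasure) auto
  also have "({s..<1} \<inter> A) \<union> ({0..<s} \<inter> A) = {0..<1} \<inter> A"
    using s by auto
  finally show ?thesis
    using vimage by (simp add: emeasure_unit_measure)
qed

text \<open>By Fubini: the fibre over \<open>p\<close> is rotated by the constant
  \<open>c p\<close>, which preserves its measure, and the base is preserved by assumption. It is
  applied twice, with constant \<open>c\<close> for the two-dimensional base and with the cocycle
  for the full system.\<close>

lemma distr_skew_product:
  assumes \<rho> [measurable]: "\<rho> \<in> measurable M M" and inv: "distr M M \<rho> = M"
    and c [measurable]: "c \<in> borel_measurable M"
  shows "distr (M \<Otimes>\<^sub>M unit_measure) (M \<Otimes>\<^sub>M unit_measure) (\<lambda>(p, z). (\<rho> p, unit_rot (c p) z))
    = M \<Otimes>\<^sub>M unit_measure" (is "distr ?P ?P ?S = ?P")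
proof (rule measure_eqI)
  have S [measurable]: "?S \<in> measurable ?P ?P" by measurable
  fix A assume "A \<in> sets (distr ?P ?P ?S)"
  then have A [measurable]: "A \<in> sets ?P" by simp
  have "emeasure (distr ?P ?P ?S) A = emeasure ?P (?S -` A \<inter> space ?P)"
    by (rule emeasure_distr[OF S A])
  also have "\<dots> = (\<integral>\<^sup>+p. emeasure unit_measure (Pair p -` (?S -` A \<inter> space ?P)) \<partial>M)"
    by (intro unit.emeasure_pair_measure_alt) measurable
  also have "\<dots> = (\<integral>\<^sup>+p. emeasure unit_measure (Pair (\<rho> p) -` A) \<partial>M)"
  proof (rule nn_integral_cong)
    fix p assume p: "p \<in> space M"
    have "Pair p -` (?S -` A \<inter> space ?P) = unit_rot (c p) -` (Pair (\<rho> p) -` A)"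
      using p by (auto simp: space_pair_measure)
    moreover have "Pair (\<rho> p) -` A \<in> sets borel"
      using sets_Pair1[OF A, of "\<rho> p"] by simp
    ultimately show "emeasure unit_measure (Pair p -` (?S -` A \<inter> space ?P))
        = emeasure unit_measure (Pair (\<rho> p) -` A)"
      by (simp only: emeasure_vimage_unit_rot)
  qed
  also have "\<dots> = (\<integral>\<^sup>+p. emeasure unit_measure (Pair p -` A) \<partial>distr M M \<rho>)"
    by (subst nn_integral_distr) (auto intro: unit.measurable_emeasure_Pair)
  also have "\<dots> = emeasure ?P A"
    unfolding inv by (rule unit.emeasure_pair_measure_alt[symmetric]) (rule A)
  finally show "emeasure (distr ?P ?P ?S) A = emeasure ?P A" .
qed simp

text \<open>One step of the Heisenberg nilrotation in coordinates on the fundamental domain \<open>[0,1)\<^sup>3\<close>;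
  the other integer translates of the cube are invariant as well, which makes the map a bijection
  of the whole space.\<close>

definition heis_cocycle :: "real \<Rightarrow> real \<Rightarrow> real \<times> real \<Rightarrow> real" where
  "heis_cocycle \<alpha> \<beta> = (\<lambda>(x, y). \<alpha> * y - (x + \<alpha>) * of_int \<lfloor>y + \<beta>\<rfloor>)"

definition heis_map :: "real \<Rightarrow> real \<Rightarrow> (real \<times> real) \<times> real \<Rightarrow> (real \<times> real) \<times> real" where
  "heis_map \<alpha> \<beta> = (\<lambda>((x, y), z).
     ((unit_rot \<alpha> x, unit_rot \<beta> y), unit_rot (heis_cocycle \<alpha> \<beta> (x, y)) z))"

definition heis_map_inv :: "real \<Rightarrow> real \<Rightarrow> (real \<times> real) \<times> real \<Rightarrow> (real \<times> real) \<times> real" where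
  "heis_map_inv \<alpha> \<beta> = (\<lambda>((x, y), z).
     ((unit_rot (- \<alpha>) x, unit_rot (- \<beta>) y),
       unit_rot (- heis_cocycle \<alpha> \<beta> (unit_rot (- \<alpha>) x, unit_rot (- \<beta>) y)) z))"

lemma heis_map_inverse: "heis_map_inv \<alpha> \<beta> (heis_map \<alpha> \<beta> p) = p"
  and heis_map_inv_inverse: "heis_map \<alpha> \<beta> (heis_map_inv \<alpha> \<beta> p) = p"
  by (auto simp: heis_map_def heis_map_inv_def unit_rot_unit_rot split: prod.split)

definition heis_measure :: "((real \<times> real) \<times> real) measure" where
  "heis_measure = (unit_measure \<Otimes>\<^sub>M unit_measure) \<Otimes>\<^sub>M unit_measure"

lemma sets_heis_measure [measurable_cong]: "sets heis_measure = sets borel"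
proof -
  have "sets (unit_measure \<Otimes>\<^sub>M unit_measure) = sets (borel :: (real \<times> real) measure)"
    by (simp only: sets_pair_measure_cong[OF sets_unit_measure sets_unit_measure] borel_prod)
  then show ?thesis
    unfolding heis_measure_def by (simp only: sets_pair_measure_cong[OF _ sets_unit_measure] borel_prod)
qed

lemma prob_space_heis_measure: "prob_space heis_measure"
  unfolding heis_measure_def by (intro prob_space_pair unit.prob_space_axioms)

lemma heis_cocycle_measurable [measurable]:
  "heis_cocycle \<alpha> \<beta> \<in> borel_measurable (unit_measure \<Otimes>\<^sub>M unit_measure)"
  unfolding heis_cocycle_def by measurable

lemma heis_map_measurable: "heis_map \<alpha> \<beta> \<in> measurable heis_measure heis_measure"
proof -
  have "heis_map \<alpha> \<beta> = (\<lambda>q. ((unit_rot \<alpha> (fst (fst q)), unit_rot \<beta> (snd (fst q))),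
      unit_rot (heis_cocycle \<alpha> \<beta> (fst q)) (snd q)))"
    by (auto simp: heis_map_def)
  then show ?thesis unfolding heis_measure_def by simp
qed

lemma heis_map_inv_measurable: "heis_map_inv \<alpha> \<beta> \<in> measurable heis_measure heis_measure"
proof -
  have "heis_map_inv \<alpha> \<beta> = (\<lambda>q. ((unit_rot (- \<alpha>) (fst (fst q)), unit_rot (- \<beta>) (snd (fst q))),
      unit_rot (- heis_cocycle \<alpha> \<beta> (unit_rot (- \<alpha>) (fst (fst q)), unit_rot (- \<beta>) (snd (fst q)))) (snd q)))"
    by (auto simp: heis_map_inv_def)
  then show ?thesis unfolding heis_measure_def by simp
qed

lemma distr_heis_map: "distr heis_measure heis_measure (heis_map \<alpha> \<beta>) = heis_measure"
proof -
  have "distr unit_measure unit_measure (unit_rot \<alpha>) = unit_measure"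
    by (rule measure_eqI)
       (auto simp: emeasure_distr emeasure_vimage_unit_rot measurable_cong_sets[OF sets_unit_measure])
  then have base: "distr (unit_measure \<Otimes>\<^sub>M unit_measure) (unit_measure \<Otimes>\<^sub>M unit_measure)
      (\<lambda>(x, y). (unit_rot \<alpha> x, unit_rot \<beta> y)) = unit_measure \<Otimes>\<^sub>M unit_measure"
    by (intro distr_skew_product) auto
  have "distr heis_measure heis_measure
      (\<lambda>(p, z). ((\<lambda>(x, y). (unit_rot \<alpha> x, unit_rot \<beta> y)) p, unit_rot (heis_cocycle \<alpha> \<beta> p) z)) = heis_measure"
    unfolding heis_measure_def by (rule distr_skew_product[OF _ base]) measurable
  moreover have "(\<lambda>(p, z). ((\<lambda>(x, y). (unit_rot \<alpha> x, unit_rot \<beta> y)) p, unit_rot (heis_cocycle \<alpha> \<beta> p) z))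
      = heis_map \<alpha> \<beta>"
    by (auto simp: heis_map_def fun_eq_iff)
  ultimately show ?thesis by simp
qed

text \<open>The bound 1/4 makes the carries in the \<beta>-coordinate rigid. The bound 1/16 keeps
  the second difference of three heights within 1/8 of 0, hence modulo 1 outside [1/4, 3/4).\<close>

definition heis_box :: "((real \<times> real) \<times> real) set" where
  "heis_box = ({0..<1} \<times> {0..<1/4}) \<times> {0..<1/16}"

lemma measure_heis_box: "measure heis_measure heis_box > 0"
proof -
  have e: "emeasure unit_measure {0..<c} = ennreal c" if "0 \<le> c" "c \<le> 1" for c :: real
    using that by (simp add: emeasure_unit_measure)
  interpret prob_space heis_measure by (rule prob_space_heis_measure)
  have "emeasure heis_measure heis_box = ennreal 1 * ennreal (1/4) * ennreal (1/16)"
    unfolding heis_measure_def heis_box_def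
    by (simp add: unit.emeasure_pair_measure_Times e del: ennreal_1)
  then show ?thesis
    by (simp add: emeasure_eq_measure flip: ennreal_mult)
qed

lemma heis_map_funpow:
  assumes "x \<in> {0..<1}" "y \<in> {0..<1}" "z \<in> {0..<1}"
  obtains i b k :: int and x' y' z' where
    "(heis_map \<alpha> \<beta> ^^ n) ((x, y), z) = ((x', y'), z')"
    "x' \<in> {0..<1}" "y' \<in> {0..<1}" "z' \<in> {0..<1}"
    "x' = x + real n * \<alpha> - of_int i" "y' = y + real n * \<beta> - of_int b"
    "z' = z + real n * (real n - 1) / 2 * \<alpha> * \<beta> + real n * \<alpha> * y - (x + real n * \<alpha>) * of_int b - of_int k"
proof -
  have rot: "unit_rot t u \<in> {0..<1}" "\<exists>j :: int. unit_rot t u = u + t - of_int j"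
    if "u \<in> {0..<1}" for t u
  proof -
    have "\<lfloor>u\<rfloor> = 0" using that by (simp add: floor_eq_iff)
    then have "unit_rot t u = frac (u + t)" by (simp add: unit_rot_def)
    then show "unit_rot t u \<in> {0..<1}" by (simp add: frac_lt_1)
    show "\<exists>j :: int. unit_rot t u = u + t - of_int j"
      using \<open>unit_rot t u = frac (u + t)\<close> by (auto simp: frac_def)
  qed
  have "\<exists>(i :: int) (b :: int) (k :: int) x' y' z'.
    (heis_map \<alpha> \<beta> ^^ n) ((x, y), z) = ((x', y'), z') \<and>
    x' \<in> {0..<1} \<and> y' \<in> {0..<1} \<and> z' \<in> {0..<1} \<and>
    x' = x + real n * \<alpha> - of_int i \<and> y' = y + real n * \<beta> - of_int b \<and>
    z' = z + real n * (real n - 1) / 2 * \<alpha> * \<beta> + real n * \<alpha> * y - (x + real n * \<alpha>) * of_int b - of_int k"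
  proof (induction n)
    case 0
    show ?case
      using assms
      by (intro exI[of _ 0] exI[of _ x] exI[of _ y] exI[of _ z]) simp
  next
    case (Suc n)
    then obtain i b k :: int and x' y' z' where IH:
      "(heis_map \<alpha> \<beta> ^^ n) ((x, y), z) = ((x', y'), z')"
      "x' \<in> {0..<1}" "y' \<in> {0..<1}" "z' \<in> {0..<1}"
      and x': "x' = x + real n * \<alpha> - of_int i" and y': "y' = y + real n * \<beta> - of_int b"
      and z': "z' = z + real n * (real n - 1) / 2 * \<alpha> * \<beta> + real n * \<alpha> * y - (x + real n * \<alpha>) * of_int b - of_int k"
      by blast
    obtain j where j: "unit_rot \<alpha> x' = x' + \<alpha> - of_int j" using rot(2)[OF IH(2)] by blast
    define b' where "b' = \<lfloor>y' + \<beta>\<rfloor>"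
    have "\<lfloor>y'\<rfloor> = 0" using IH(3) by (simp add: floor_eq_iff)
    then have y'': "unit_rot \<beta> y' = y' + \<beta> - of_int b'"
      by (simp add: unit_rot_def frac_def b'_def)
    obtain l where l: "unit_rot (heis_cocycle \<alpha> \<beta> (x', y')) z'
        = z' + (\<alpha> * y' - (x' + \<alpha>) * of_int b') - of_int l"
      using rot(2)[OF IH(4), of "heis_cocycle \<alpha> \<beta> (x', y')"] by (auto simp: heis_cocycle_def b'_def)
    define c where "c = real n * (real n - 1) / 2"
    have c: "real (Suc n) * (real (Suc n) - 1) / 2 = c + real n"
      by (simp add: c_def field_simps)
    show ?case
    proof (intro exI conjI)
      show "(heis_map \<alpha> \<beta> ^^ Suc n) ((x, y), z)
          = ((unit_rot \<alpha> x', unit_rot \<beta> y'), unit_rot (heis_cocycle \<alpha> \<beta> (x', y')) z')"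
        unfolding funpow.simps comp_apply IH(1) by (simp add: heis_map_def)
      show "unit_rot \<alpha> x' = x + real (Suc n) * \<alpha> - of_int (i + j)"
        unfolding j unfolding x' by (simp add: algebra_simps)
      show "unit_rot \<beta> y' = y + real (Suc n) * \<beta> - of_int (b + b')"
        unfolding y'' unfolding y' by (simp add: algebra_simps)
      \<comment> \<open>Replacing x' by x + n \<alpha> in the product with b' changes it by the
        integer i b', which joins k. The term -\<alpha> b needed for the new factor x + (n + 1)
        \<alpha> is supplied by \<alpha> y'.\<close>
      show "unit_rot (heis_cocycle \<alpha> \<beta> (x', y')) z' = z + real (Suc n) * (real (Suc n) - 1) / 2 * \<alpha> * \<beta>
          + real (Suc n) * \<alpha> * y - (x + real (Suc n) * \<alpha>) * of_int (b + b') - of_int (k + l - i * b')"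
        unfolding l unfolding z' x' y' c c_def[symmetric]
        by (simp add: algebra_simps)
    qed (use rot(1) IH in auto)
  qed
  then show ?thesis by (elim exE conjE) (rule that; assumption)
qed

lemma heis_map_no_double_return:
  assumes r: "r \<in> heis_set \<alpha> \<beta>"
    and p: "p \<in> heis_box" "(heis_map \<alpha> \<beta> ^^ r) p \<in> heis_box" "(heis_map \<alpha> \<beta> ^^ (2 * r)) p \<in> heis_box"
  shows False
proof -
  obtain x y z where xyz: "p = ((x, y), z)" by (metis surj_pair)
  then have box: "x \<in> {0..<1}" "y \<in> {0..<1/4}" "z \<in> {0..<1/16}"
    using p(1) by (auto simp: heis_box_def)
  then have unit: "x \<in> {0..<1}" "y \<in> {0..<1}" "z \<in> {0..<1}" by auto
  obtain i b k :: int and x' y' z' where 1: "(heis_map \<alpha> \<beta> ^^ r) ((x, y), z) = ((x', y'), z')"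
    "y' = y + real r * \<beta> - of_int b"
    "z' = z + real r * (real r - 1) / 2 * \<alpha> * \<beta> + real r * \<alpha> * y - (x + real r * \<alpha>) * of_int b - of_int k"
    by (rule heis_map_funpow[OF unit, where n = r and \<alpha> = \<alpha> and \<beta> = \<beta>]) (rule that)
  obtain i2 b2 k2 :: int and x2 y2 z2 where 2: "(heis_map \<alpha> \<beta> ^^ (2 * r)) ((x, y), z) = ((x2, y2), z2)"
    "y2 = y + real (2 * r) * \<beta> - of_int b2"
    "z2 = z + real (2 * r) * (real (2 * r) - 1) / 2 * \<alpha> * \<beta> + real (2 * r) * \<alpha> * y
      - (x + real (2 * r) * \<alpha>) * of_int b2 - of_int k2"
    by (rule heis_map_funpow[OF unit, where n = "2 * r" and \<alpha> = \<alpha> and \<beta> = \<beta>]) (rule that)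
  have z': "y' \<in> {0..<1/4}" "z' \<in> {0..<1/16}" and z2: "y2 \<in> {0..<1/4}" "z2 \<in> {0..<1/16}"
    using p(2,3) unfolding xyz 1(1) 2(1) by (auto simp: heis_box_def)
  \<comment> \<open>Here b2 - 2 b = -(y2 - 2 y' + y), and all three \<beta>-coordinates lie in [0,
    1/4).\<close>
  have "\<bar>real_of_int (b2 - 2 * b)\<bar> < 1"
    using box z' z2 1(2) 2(2) by (auto simp: abs_if)
  then have "b2 - 2 * b = 0" by linarith
  then have b2: "b2 = 2 * b" by simp
  \<comment> \<open>Since r \<beta> - b = y' - y is smaller than 1/4 in absolute value, b is the
    integer nearest to r \<beta>.\<close>
  have b: "\<lfloor>real r * \<beta> + 1 / 2\<rfloor> = b"
    using box z' 1(2) by (intro floor_unique) auto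
  define t where "t = z2 - 2 * z' + z"
  \<comment> \<open>The second difference removes z and the term linear in y; the terms x b cancel
    because b2 = 2 b. What is left depends on r alone, up to integers.\<close>
  have "heis_phase \<alpha> \<beta> r = t + of_int (k2 - 2 * k)"
    unfolding t_def 1(3) 2(3) heis_phase_def b b2
    by (simp add: algebra_simps power2_eq_square add_divide_distrib diff_divide_distrib)
  then have "frac (heis_phase \<alpha> \<beta> r) = frac t"
    by (simp add: frac_def)
  then have t: "frac t \<in> {1/4..<3/4}"
    using r by (simp add: heis_set_def)
  have "\<bar>t\<bar> < 1/8"
    using box z' z2 by (auto simp: t_def abs_if)
  then have "\<lfloor>t\<rfloor> = 0 \<or> \<lfloor>t\<rfloor> = - 1" by linarith
  with t \<open>\<bar>t\<bar> < 1/8\<close> show False by (auto simp: frac_def)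
qed

section \<open>Transport to the real line\<close>

text \<open>A bare bijection from cardinal arithmetic suffices, since topology and measure are
  carried along with it.\<close>

lemma ex_bij_real_triple: "\<exists>\<phi> :: (real \<times> real) \<times> real \<Rightarrow> real. bij \<phi>"
proof -
  obtain f :: "real \<times> real \<Rightarrow> real" where f: "bij f"
    using card_of_Times_same_infinite[OF infinite_UNIV_char_0[where 'a = real]]
    unfolding card_of_ordIso[symmetric] by auto
  have "bij (f \<circ> map_prod f id)"
    using f by (intro bij_comp bijI prod.inj_map map_prod_surj) (simp_all add: bij_is_inj bij_is_surj)
  then show ?thesis by (auto simp: comp_def)
qed

text \<open>Double recurrence is tested on systems whose points are reals, while the nilrotation
  lives in three dimensions. The line receives the topology that makes \<phi> a homeomorphism, so it
  is Polish whatever \<phi> does to the usual topology.\<close>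

locale transported_system =
  fixes P :: "'a :: euclidean_space measure" and T T' :: "'a \<Rightarrow> 'a" and \<phi> :: "'a \<Rightarrow> real"
  assumes prob: "prob_space P" and sets_P: "sets P = sets borel"
    and T: "T \<in> measurable P P" and T': "T' \<in> measurable P P"
    and inverse: "\<And>x. T' (T x) = x" "\<And>x. T (T' x) = x"
    and preserving: "distr P P T = P" and \<phi>: "bij \<phi>"
begin

definition topo :: "real topology" where
  "topo = pullback_topology UNIV (inv \<phi>) euclidean"

definition pushed :: "real measure" where
  "pushed = distr P (sigma UNIV {U. openin topo U}) \<phi>"

definition transport :: "('a \<Rightarrow> 'a) \<Rightarrow> real \<Rightarrow> real" where
  "transport S = \<phi> \<circ> S \<circ> inv \<phi>"

lemma inv_\<phi> [simp]: "inv \<phi> (\<phi> x) = x" "\<phi> (inv \<phi> y) = y"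
  using \<phi> by (simp_all add: bij_is_inj bij_is_surj surj_f_inv_f)

lemma space_P [simp]: "space P = UNIV"
  using sets_eq_imp_space_eq[OF sets_P] by simp

lemma openin_topo: "openin topo V \<longleftrightarrow> open (\<phi> -` V)"
proof
  assume "openin topo V"
  then obtain U where "open U" "V = inv \<phi> -` U"
    by (auto simp: topo_def openin_pullback_topology)
  then show "open (\<phi> -` V)" by (simp add: vimage_def)
next
  assume "open (\<phi> -` V)"
  moreover have "V = inv \<phi> -` (\<phi> -` V)" by auto
  ultimately show "openin topo V"
    by (auto simp: topo_def openin_pullback_topology)
qed

lemma topspace_topo [simp]: "topspace topo = UNIV"
  by (simp add: topo_def topspace_pullback_topology)

lemma polish_topo: "polish_topology topo"
  unfolding polish_topology_def
proof
  have "homeomorphic_maps euclidean topo \<phi> (inv \<phi>)"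
    unfolding homeomorphic_maps_def continuous_map_def
  proof (intro conjI allI impI)
    fix U :: "'a set" assume "openin euclidean U"
    then show "openin topo {x \<in> topspace topo. inv \<phi> x \<in> U}"
      by (simp add: openin_topo vimage_def)
  qed (auto simp: openin_topo vimage_def)
  then show "completely_metrizable_space topo"
    using homeomorphic_completely_metrizable_space[OF homeomorphic_maps_imp_homeomorphic_space]
      completely_metrizable_space_euclidean by blast
  obtain D :: "'a set" where D: "countable D" "\<And>X. open X \<Longrightarrow> X \<noteq> {} \<Longrightarrow> \<exists>d\<in>D. d \<in> X"
    using countable_dense_setE by blast
  show "\<exists>D. countable D \<and> D \<subseteq> topspace topo \<and> topo closure_of D = topspace topo"
  proof (intro exI[of _ "\<phi> ` D"] conjI)
    show "topo closure_of (\<phi> ` D) = topspace topo"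
      unfolding dense_intersects_open
    proof (intro allI impI)
      fix V assume V: "openin topo V \<and> V \<noteq> {}"
      then obtain v where "v \<in> V" by blast
      then have "inv \<phi> v \<in> \<phi> -` V" by simp
      then have "\<phi> -` V \<noteq> {}" by blast
      with V D(2)[of "\<phi> -` V"] show "\<phi> ` D \<inter> V \<noteq> {}"
        by (auto simp: openin_topo)
    qed
  qed (use D in auto)
qed

lemma space_pushed [simp]: "space pushed = UNIV"
  by (simp add: pushed_def space_measure_of_conv)

lemma sets_pushed: "sets pushed = sigma_sets UNIV {U. openin topo U}"
  by (simp add: pushed_def)

lemma measurable_\<phi>: "\<phi> \<in> measurable P pushed"
proof -
  have "\<phi> \<in> measurable P (sigma UNIV {U. openin topo U})"
    by (rule measurable_measure_of) (auto simp: openin_topo sets_P)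
  then show ?thesis by (simp add: pushed_def)
qed

lemma measurable_inv_\<phi>: "inv \<phi> \<in> measurable pushed P"
proof -
  have "inv \<phi> \<in> measurable pushed borel"
  proof (rule borel_measurableI)
    fix S :: "'a set" assume "open S"
    then have "openin topo (inv \<phi> -` S)" by (simp add: openin_topo vimage_def)
    then show "inv \<phi> -` S \<inter> space pushed \<in> sets pushed"
      by (auto simp: sets_pushed)
  qed
  then show ?thesis by (simp add: measurable_cong_sets[OF refl sets_P])
qed

lemma pushed_eq: "pushed = distr P pushed \<phi>"
  by (rule trans[OF pushed_def], rule distr_cong) (simp_all add: sets_pushed)

lemma prob_space_pushed: "prob_space pushed"
  by (subst pushed_eq) (rule prob_space.prob_space_distr[OF prob measurable_\<phi>])

lemma measurable_transport:
  assumes "S \<in> measurable P P"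
  shows "transport S \<in> measurable pushed pushed"
  unfolding transport_def
  by (rule measurable_comp[OF measurable_inv_\<phi> measurable_comp[OF assms measurable_\<phi>]])

lemma distr_transport:
  assumes S: "S \<in> measurable P P" and "distr P P S = P"
  shows "distr pushed pushed (transport S) = pushed"
proof -
  have "distr pushed pushed (transport S) = distr (distr P pushed \<phi>) pushed (transport S)"
    using pushed_eq by simp
  also have "\<dots> = distr P pushed (transport S \<circ> \<phi>)"
    by (rule distr_distr[OF measurable_transport[OF S] measurable_\<phi>])
  also have "transport S \<circ> \<phi> = \<phi> \<circ> S"
    by (auto simp: transport_def)
  also have "distr P pushed (\<phi> \<circ> S) = distr (distr P P S) pushed \<phi>"
    by (rule distr_distr[OF measurable_\<phi> S, symmetric])
  also have "\<dots> = pushed"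
    unfolding assms(2) by (rule pushed_eq[symmetric])
  finally show ?thesis .
qed

text \<open>A measure-preserving map pulls null sets back to null sets, so it stays measurable after
  both sides are completed.\<close>

lemma completion_transport:
  assumes S: "S \<in> measurable P P" and pres: "distr P P S = P"
  shows "transport S \<in> measurable (completion pushed) (completion pushed)"
    and "distr (completion pushed) (completion pushed) (transport S) = completion pushed"
proof -
  have m: "transport S \<in> measurable (completion pushed) pushed"
    by (intro measurable_completion measurable_transport S)
  have d: "distr (completion pushed) pushed (transport S) = pushed"
    by (simp add: distr_completion measurable_transport S distr_transport pres)
  show "transport S \<in> measurable (completion pushed) (completion pushed)"
    using m by (rule completion.measurable_completion2) (simp add: d)
  show "distr (completion pushed) (completion pushed) (transport S) = completion pushed"
    using completion.completion_distr_eq[OF m] by (simp add: d)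
qed

lemma transport_inverse: "transport T' (transport T x) = x" "transport T (transport T' x) = x"
  by (simp_all add: transport_def inverse)

lemma bij_transport: "bij (transport T)"
  by (rule o_bij[of "transport T'"]) (auto simp: transport_inverse)

lemma mp_system_transport: "mp_system (completion pushed) (transport T)"
proof -
  \<comment> \<open>A system must also have a measurable inverse on the completed space. By
    \<open>completion_transport\<close> this follows once T' is known to preserve
    \<open>P\<close>.\<close>
  have "distr P P T' = distr (distr P P T) P T'" by (simp add: preserving)
  also have "\<dots> = distr P P (T' \<circ> T)" by (rule distr_distr[OF T' T])
  also have "T' \<circ> T = id" by (auto simp: inverse)
  finally have T'_pres: "distr P P T' = P" by (simp add: id_def distr_id)
  have "the_inv_into UNIV (transport T) = transport T'"
    by (rule ext, rule the_inv_into_f_eq) (auto simp: transport_inverse bij_transport bij_is_inj)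
  then show ?thesis
    using completion_transport[OF T preserving] completion_transport(1)[OF T' T'_pres]
      polish_topo prob_space_pushed bij_transport
    unfolding mp_system_def lebesgue_prob_space_def
    by (auto simp: sets_pushed intro!: exI[of _ topo] exI[of _ pushed])
qed

lemma transport_funpow: "(transport T ^^ n) (\<phi> x) = \<phi> ((T ^^ n) x)"
  by (induction n) (simp_all add: transport_def)

lemma image_in_sets: "A \<in> sets borel \<Longrightarrow> \<phi> ` A \<in> sets pushed"
proof -
  assume A: "A \<in> sets borel"
  have "\<phi> ` A = inv \<phi> -` A"
    using \<phi> by (simp add: bij_vimage_eq_inv_image bij_imp_bij_inv inv_inv_eq)
  with A show ?thesis
    using measurable_sets[OF measurable_inv_\<phi>, of A] by (simp add: sets_P)
qed

lemma measure_image: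
  assumes A: "A \<in> sets borel"
  shows "measure (completion pushed) (\<phi> ` A) = measure P A"
proof -
  have "\<phi> -` (\<phi> ` A) = A" using \<phi> by (simp add: bij_is_inj inj_vimage_image_eq)
  then have "measure (distr P pushed \<phi>) (\<phi> ` A) = measure P A"
    by (simp add: measure_distr[OF measurable_\<phi> image_in_sets[OF A]])
  then show ?thesis
    using image_in_sets[OF A] by (simp flip: pushed_eq)
qed

lemma not_good_for_double_recurrence:
  assumes A: "A \<in> sets borel" and pos: "measure P A > 0"
    and avoid: "\<And>r x. r \<in> R \<Longrightarrow> x \<in> A \<Longrightarrow> (T ^^ r) x \<in> A \<Longrightarrow> (T ^^ (2 * r)) x \<in> A \<Longrightarrow> False"
  shows "\<not> good_for_double_recurrence (int ` R)"
proof
  assume "good_for_double_recurrence (int ` R)"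
  then have "mp_system (completion pushed) (transport T) \<and> \<phi> ` A \<in> sets (completion pushed)
      \<and> measure (completion pushed) (\<phi> ` A) > 0 \<longrightarrow> (\<exists>r\<in>int ` R. r \<noteq> 0 \<and>
        measure (completion pushed) (\<phi> ` A \<inter> preimage_iterate (completion pushed) (transport T) r (\<phi> ` A)
          \<inter> preimage_iterate (completion pushed) (transport T) (2 * r) (\<phi> ` A)) > 0)"
    unfolding good_for_double_recurrence_def by blast
  then obtain r where r: "r \<in> R"
    and "measure (completion pushed) (\<phi> ` A \<inter> preimage_iterate (completion pushed) (transport T) (int r) (\<phi> ` A)
          \<inter> preimage_iterate (completion pushed) (transport T) (2 * int r) (\<phi> ` A)) > 0"
    using mp_system_transport image_in_sets[OF A] pos by (auto simp: measure_image[OF A])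
  \<comment> \<open>The triple intersection is empty, not merely null, because \<open>avoid\<close>
    holds at every point.\<close>
  moreover have "\<phi> ` A \<inter> preimage_iterate (completion pushed) (transport T) (int r) (\<phi> ` A)
          \<inter> preimage_iterate (completion pushed) (transport T) (2 * int r) (\<phi> ` A) = {}"
  proof -
    have nat2: "nat (2 * int r) = 2 * r" by simp
    have mem: "\<phi> x \<in> \<phi> ` A \<longleftrightarrow> x \<in> A" for x
      using \<phi> by (simp add: bij_is_inj inj_image_mem_iff)
    show ?thesis
      using avoid[OF r]
      by (auto simp: preimage_iterate_def int_iterate_def nat2 transport_funpow mem
          inj_eq[OF bij_is_inj[OF \<phi>]])
  qed
  ultimately show False by simp
qed

end

text \<open>Once \<beta> is fixed, only countably many \<alpha> are excluded. The triples with m = 0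
  merely add the value 0 to \<open>X\<close>, as division by zero yields 0.\<close>

lemma ex_irrational_independent:
  obtains \<alpha> \<beta> :: real where "\<beta> \<notin> \<rat>"
    "\<And>m p q :: int. m \<noteq> 0 \<Longrightarrow> of_int m * \<alpha> \<noteq> of_int p + of_int q * \<beta>"
proof -
  have "\<exists>\<beta> :: real. \<beta> \<notin> \<rat>"
    using uncountable_UNIV_real countable_rat by (metis UNIV_eq_I)
  then obtain \<beta> :: real where \<beta>: "\<beta> \<notin> \<rat>" by blast
  define X where "X = (\<lambda>(m :: int, p :: int, q :: int). (of_int p + of_int q * \<beta>) / of_int m) ` UNIV"
  have "countable X" by (simp add: X_def)
  then have "X \<noteq> UNIV" using uncountable_UNIV_real by metis
  then obtain \<alpha> where \<alpha>: "\<alpha> \<notin> X" by blast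
  show thesis
  proof (rule that[OF \<beta>])
    fix m p q :: int assume "m \<noteq> 0"
    show "of_int m * \<alpha> \<noteq> of_int p + of_int q * \<beta>"
    proof
      assume "of_int m * \<alpha> = of_int p + of_int q * \<beta>"
      then have "\<alpha> = (\<lambda>(m :: int, p :: int, q :: int). (of_int p + of_int q * \<beta>) / of_int m) (m, p, q)"
        using \<open>m \<noteq> 0\<close> by (simp add: field_simps)
      then show False using \<alpha> unfolding X_def by blast
    qed
  qed
qed

theorem theorem7p2:
  shows "\<exists>r :: nat \<Rightarrow> nat. (\<forall>n\<ge>1. r n > 0) \<and>
    (\<forall>\<gamma> \<delta> :: real. \<gamma> \<notin> \<rat> \<or> \<delta> \<notin> \<rat> \<longrightarrow>
       uniformly_distributed_mod1 (\<lambda>n. (real (r n))\<^sup>2 * \<gamma> + real (r n) * \<delta>)) \<and>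
    (\<forall>d::nat. d \<ge> 1 \<longrightarrow> has_positive_density {int n | n. n \<ge> 1 \<and> d dvd r n}) \<and>
    \<not> good_for_double_recurrence {int (r n) | n. n \<ge> 1}"
proof -
  obtain \<alpha> \<beta> :: real where irr: "\<beta> \<notin> \<rat>"
    and indep: "\<And>m p q :: int. m \<noteq> 0 \<Longrightarrow> of_int m * \<alpha> \<noteq> of_int p + of_int q * \<beta>"
    by (rule ex_irrational_independent) (rule that)
  define R where "R = heis_set \<alpha> \<beta>"
  \<comment> \<open>\<open>enumerate\<close> starts at index 0, so the shift makes
    \<open>r 1\<close> the least element of R; \<open>r 0\<close> repeats it.\<close>
  define r where "r n = enumerate R (n - 1)" for n
  have half: "mean_zero (\<lambda>n. of_real (indicator R n - 1 / 2))"
    unfolding R_def by (rule mean_zero_heis_set_density[OF irr indep])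
  have zero: "0 \<notin> R"
    by (simp add: R_def zero_notin_heis_set)
  have density: "infinite R" "(\<lambda>N. real (card {n \<in> {1..N}. r n \<in> Q}) / real N) \<longlonglongrightarrow> c"
    if "mean_zero (\<lambda>n. of_real ((indicator Q n - c) * indicator R n))" for Q c
    using relative_density_enumerate[OF zero _ half that] by (simp_all add: r_def)
  have div: "mean_zero (\<lambda>n. of_real ((indicator {n. d dvd n} n - 1 / real d) * indicator R n))"
    if "d \<ge> 1" for d
    unfolding R_def by (rule heis_set_divisibility[OF irr indep that])
  have equi: "mean_zero (\<lambda>n. of_real
      ((indicator {n. frac ((real n)\<^sup>2 * \<gamma> + real n * \<delta>) \<in> {a..<b}} n - (b - a)) * indicator R n))"
    if "\<gamma> \<notin> \<rat> \<or> \<delta> \<notin> \<rat>" "0 \<le> a" "a < b" "b \<le> 1" for \<gamma> \<delta> a b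
    unfolding R_def by (rule heis_set_equidistribution[OF irr indep that])
  \<comment> \<open>Infinitude comes with every instance of \<open>density\<close>; the divisor 1
    provides one.\<close>
  have inf: "infinite R"
    using density(1)[OF div[of 1]] by simp
  have r_in: "r n \<in> R" for n
    using enumerate_in_set[OF inf] by (simp add: r_def)
  show ?thesis
  proof (intro exI[of _ r] conjI allI impI)
    show "r n > 0" for n
      using r_in[of n] zero by (metis gr0I)
    fix \<gamma> \<delta> :: real assume gd: "\<gamma> \<notin> \<rat> \<or> \<delta> \<notin> \<rat>"
    show "uniformly_distributed_mod1 (\<lambda>n. (real (r n))\<^sup>2 * \<gamma> + real (r n) * \<delta>)"
      unfolding uniformly_distributed_mod1_def
    proof (intro allI impI)
      fix a b :: real assume ab: "0 \<le> a \<and> a < b \<and> b \<le> 1"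
      show "(\<lambda>N. real (card {n \<in> {1..N}. frac ((real (r n))\<^sup>2 * \<gamma> + real (r n) * \<delta>) \<in> {a..<b}}) / real N)
          \<longlonglongrightarrow> b - a"
        using density(2)[OF equi[OF gd, of a b]] ab by simp
    qed
  next
    fix d :: nat assume d: "d \<ge> 1"
    show "has_positive_density {int n | n. n \<ge> 1 \<and> d dvd r n}"
      using density(2)[OF div[OF d]] d
      by (intro has_positive_density_of_nat[of _ "1 / real d"]) auto
  next
    obtain \<phi> :: "(real \<times> real) \<times> real \<Rightarrow> real" where \<phi>: "bij \<phi>"
      using ex_bij_real_triple by blast
    interpret transported_system heis_measure "heis_map \<alpha> \<beta>" "heis_map_inv \<alpha> \<beta>" \<phi>
      by (rule transported_system.intro)
        (simp_all add: \<phi> prob_space_heis_measure sets_heis_measure heis_map_measurable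
          heis_map_inv_measurable heis_map_inverse heis_map_inv_inverse distr_heis_map)
    have "heis_box \<in> sets borel"
      unfolding heis_box_def by (intro borel_Times) auto
    then have "\<not> good_for_double_recurrence (int ` (r ` {1..}))"
    proof (rule not_good_for_double_recurrence[OF _ measure_heis_box])
      fix k p
      assume "k \<in> r ` {1..}" and p: "p \<in> heis_box" "(heis_map \<alpha> \<beta> ^^ k) p \<in> heis_box"
        "(heis_map \<alpha> \<beta> ^^ (2 * k)) p \<in> heis_box"
      then have "k \<in> heis_set \<alpha> \<beta>" using r_in by (auto simp: R_def)
      from this p show False by (rule heis_map_no_double_return)
    qed
    moreover have "int ` (r ` {1..}) = {int (r n) | n. n \<ge> 1}" by auto
    ultimately show "\<not> good_for_double_recurrence {int (r n) | n. n \<ge> 1}" by simp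
  qed
qed

end
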